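(* Let $M$ be a matroid on a finite set. Suppose that $\omega(N)\ge 0$ for every minor $N$ of $M$, and suppose also that the contraction $M/F$ is connected for every proper flat $F$ of $M$. Then all coefficients of the polynomial $g_M(t)$ are nonnegative.
   Context: Let $M$ be a matroid of rank $r$ on a finite set $E$, $|E|=n$, and let $c(M)$ be its number of connected components. Speyer's $g$-polynomial $g_M(t)\in\mathbb Z[t]$ is given as follows (in the form of Berget–Eur–Spink–Tseng, equivalent to the original $K$-theoretic definition). If $E=\emptyset$, $g_M=1$. If $M$ has a loop or a coloop, $g_M=0$. Otherwise, for each total ordering $w=(w_1,\dots,w_n)$ of $E$ (thought of as the region $z_{w_1}>\dots>z_{w_n}$ of $\mathbb R^E$), let $B_w$ be the greedy basis: $w_k\in B_w$ iff $\operatorname{rank}\{w_1,\dots,w_k\}>\operatorname{rank}\{w_1,\dots,w_{k-1}\}$. In the polynomial ring $\mathbb Z[z_e:e\in E]$, let $x^w$ be the list of the $z_b$, $b\in B_w$; let $y^w=(y^w_1,\dots,y^w_{n-r})$ be the list of the $-z_c$, $c\in E\setminus B_w$, ordered so that $y^w_1$ corresponds to the $c$ occurring last in $w$; let $\alpha^w=-z_{w_n}$. For a family $f=(f_w)_w$ put $\deg f=\sum_w f_w/\prod_{i=1}^{n-1}(z_{w_i}-z_{w_{i+1}})$. With $\boldsymbol e_k$ the $k$-th elementary symmetric polynomial, $$g_M(t)=(-1)^{c(M)}\sum_{i=1}^{r}(-t)^i\sum_{j=0}^{i-1}\deg\big(\alpha^j\,\boldsymbol e_{i-j-1}(-y)\,\boldsymbol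 e_{r-i}(x)\,\boldsymbol e_{n-r}(y)\big),$$ each $\deg$ here being an integer constant. The invariant $\omega(M)$ is the coefficient of $t^r$ in $g_M(t)$, where $r=\operatorname{rank} M$. *)

theory Defs
  imports
    "HOL-Library.Poly_Mapping"
    "HOL-Computational_Algebra.Polynomial"
    "HOL-Computational_Algebra.Fraction_Field"
    "HOL-Combinatorics.Multiset_Permutations"
begin

section \<open>Matroids\<close>

text \<open>
  A matroid is given by its ground set and its rank function. Only the values of the rank function
  on subsets of the ground set are meaningful.
\<close>

record 'a ranked_set =
  ground :: "'a set"
  rk :: "'a set \<Rightarrow> nat"

definition matroid :: "'a ranked_set \<Rightarrow> bool" where
  "matroid M \<longleftrightarrow> finite (ground M) \<and>
     (\<forall>A \<subseteq> ground M. rk M A \<le> card A) \<and>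
     (\<forall>A B. A \<subseteq> B \<and> B \<subseteq> ground M \<longrightarrow> rk M A \<le> rk M B) \<and>
     (\<forall>A B. A \<subseteq> ground M \<and> B \<subseteq> ground M \<longrightarrow>
        rk M (A \<union> B) + rk M (A \<inter> B) \<le> rk M A + rk M B)"

definition mrank :: "'a ranked_set \<Rightarrow> nat" where
  "mrank M = rk M (ground M)"

definition is_loop :: "'a ranked_set \<Rightarrow> 'a \<Rightarrow> bool" where
  "is_loop M e \<longleftrightarrow> e \<in> ground M \<and> rk M {e} = 0"

definition is_coloop :: "'a ranked_set \<Rightarrow> 'a \<Rightarrow> bool" where
  "is_coloop M e \<longleftrightarrow> e \<in> ground M \<and> rk M (ground M - {e}) < mrank M"

definition indep :: "'a ranked_set \<Rightarrow> 'a set \<Rightarrow> bool" where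
  "indep M A \<longleftrightarrow> A \<subseteq> ground M \<and> rk M A = card A"

definition circuit :: "'a ranked_set \<Rightarrow> 'a set \<Rightarrow> bool" where
  "circuit M C \<longleftrightarrow> C \<subseteq> ground M \<and> \<not> indep M C \<and> (\<forall>D. D \<subset> C \<longrightarrow> indep M D)"

definition flat :: "'a ranked_set \<Rightarrow> 'a set \<Rightarrow> bool" where
  "flat M F \<longleftrightarrow> F \<subseteq> ground M \<and> (\<forall>e \<in> ground M - F. rk M F < rk M (insert e F))"

definition delete :: "'a ranked_set \<Rightarrow> 'a set \<Rightarrow> 'a ranked_set" where
  "delete M D = \<lparr>ground = ground M - D, rk = rk M\<rparr>"

definition contract :: "'a ranked_set \<Rightarrow> 'a set \<Rightarrow> 'a ranked_set" where
  "contract M C = \<lparr>ground = ground M - C, rk = (\<lambda>A. rk M (A \<union> C) - rk M C)\<rparr>"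

definition is_minor :: "'a ranked_set \<Rightarrow> 'a ranked_set \<Rightarrow> bool" where
  "is_minor N M \<longleftrightarrow>
     (\<exists>C D. C \<subseteq> ground M \<and> D \<subseteq> ground M \<and> C \<inter> D = {} \<and> N = delete (contract M C) D)"

text \<open>
  For a matroid \<open>same_component M\<close> is an equivalence relation on the ground set, and its classes are
  the connected components.
\<close>

definition same_component :: "'a ranked_set \<Rightarrow> ('a \<times> 'a) set" where
  "same_component M = {(e, f). e \<in> ground M \<and> f \<in> ground M \<and>
     (e = f \<or> (\<exists>C. circuit M C \<and> e \<in> C \<and> f \<in> C))}"

definition components :: "'a ranked_set \<Rightarrow> 'a set set" where
  "components M = ground M // same_component M"

text \<open>
  The matroid on the empty set has no component and counts as connected here.
\<close>

definition connected_matroid :: "'a ranked_set \<Rightarrow> bool" where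
  "connected_matroid M \<longleftrightarrow> card (components M) \<le> 1"


section \<open>The polynomial ring over the integers\<close>

text \<open>
  The type \<open>('a \<Rightarrow>\<^sub>0 nat) \<Rightarrow>\<^sub>0 int\<close> of polynomials is an integral domain in the library only for
  linearly ordered \<open>'a\<close>. The copy below is one for every \<open>'a\<close>, so that its field of fractions can
  be formed without ordering the ground set.
\<close>

lemma poly_mapping_no_zero_divisors:
  fixes p q :: "('a \<Rightarrow>\<^sub>0 nat) \<Rightarrow>\<^sub>0 int"
  assumes "p \<noteq> 0" "q \<noteq> 0"
  shows "p * q \<noteq> 0"
proof -
  define K where "K = Poly_Mapping.keys p \<union> Poly_Mapping.keys q"
  define V where "V = (\<Union>m\<in>K. Poly_Mapping.keys m)"
  have finV: "finite V" unfolding V_def K_def by auto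
  then obtain f :: "'a \<Rightarrow> nat" where f: "inj_on f V"
    using finite_imp_inj_to_nat_seg by blast
  define h :: "('a \<Rightarrow>\<^sub>0 nat) \<Rightarrow> (nat \<Rightarrow>\<^sub>0 nat)"
    where "h m = (\<Sum>a\<in>V. Poly_Mapping.single (f a) (Poly_Mapping.lookup m a))" for m
  have h_add: "h (m + n) = h m + h n" for m n
    unfolding h_def by (simp add: lookup_add single_add sum.distrib)
  have lookup_h: "Poly_Mapping.lookup (h m) (f b) = Poly_Mapping.lookup m b" if "b \<in> V" for m b
  proof -
    have "Poly_Mapping.lookup (h m) (f b) =
        (\<Sum>a\<in>V. Poly_Mapping.lookup (Poly_Mapping.single (f a) (Poly_Mapping.lookup m a)) (f b))"
      unfolding h_def by (simp add: lookup_sum)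
    also have "\<dots> = (\<Sum>a\<in>V. if a = b then Poly_Mapping.lookup m b else 0)"
      using that f by (intro sum.cong) (auto simp: lookup_single when_def inj_on_def)
    also have "\<dots> = Poly_Mapping.lookup m b" using that finV by simp
    finally show ?thesis .
  qed
  have h_inj: "m = n" if "m \<in> K" "n \<in> K" "h m = h n" for m n
  proof (rule poly_mapping_eqI)
    fix b
    show "Poly_Mapping.lookup m b = Poly_Mapping.lookup n b"
    proof (cases "b \<in> V")
      case True
      then show ?thesis using lookup_h that(3) by metis
    next
      case False
      then have "b \<notin> Poly_Mapping.keys m" "b \<notin> Poly_Mapping.keys n"
        using that unfolding V_def by auto
      then show ?thesis by (simp add: in_keys_iff)
    qed
  qed
  have max_key: "\<exists>m\<in>Poly_Mapping.keys r. \<forall>l\<in>Poly_Mapping.keys r. h l \<le> h m"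
    if "r \<noteq> 0" for r :: "('a \<Rightarrow>\<^sub>0 nat) \<Rightarrow>\<^sub>0 int"
  proof -
    have *: "finite (h ` Poly_Mapping.keys r)" "h ` Poly_Mapping.keys r \<noteq> {}"
      using that by auto
    from Max_in[OF *] obtain m where "m \<in> Poly_Mapping.keys r" "h m = Max (h ` Poly_Mapping.keys r)"
      by auto
    then show ?thesis using *(1) by (metis Max_ge imageI)
  qed
  obtain m where m: "m \<in> Poly_Mapping.keys p" "\<And>l. l \<in> Poly_Mapping.keys p \<Longrightarrow> h l \<le> h m"
    using max_key[OF assms(1)] by blast
  obtain n where n: "n \<in> Poly_Mapping.keys q" "\<And>l. l \<in> Poly_Mapping.keys q \<Longrightarrow> h l \<le> h n"
    using max_key[OF assms(2)] by blast
  have uniq: "l = m \<and> k = n"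
    if "l \<in> Poly_Mapping.keys p" "k \<in> Poly_Mapping.keys q" "m + n = l + k" for l k
  proof -
    have le: "h l \<le> h m" "h k \<le> h n" using m n that by auto
    have eq: "h m + h n = h l + h k" using that(3) h_add by metis
    have "h l = h m"
      using le eq by (metis add_less_le_mono order_less_irrefl order_le_imp_less_or_eq)
    then have "h k = h n" using eq by simp
    with \<open>h l = h m\<close> show ?thesis using h_inj that m(1) n(1) unfolding K_def by blast
  qed
  have "Poly_Mapping.lookup (p * q) (m + n) =
      Sum_any (\<lambda>l. Poly_Mapping.lookup p l * Sum_any (\<lambda>k. Poly_Mapping.lookup q k when m + n = l + k))"
    by (rule lookup_mult)
  also have "\<dots> = Sum_any (\<lambda>l. (Poly_Mapping.lookup p m * Poly_Mapping.lookup q n) when l = m)"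
  proof (rule Sum_any.cong)
    fix l
    show "Poly_Mapping.lookup p l * Sum_any (\<lambda>k. Poly_Mapping.lookup q k when m + n = l + k) =
       ((Poly_Mapping.lookup p m * Poly_Mapping.lookup q n) when l = m)"
    proof (cases "l \<in> Poly_Mapping.keys p")
      case True
      have "Sum_any (\<lambda>k. Poly_Mapping.lookup q k when m + n = l + k) =
          Sum_any (\<lambda>k. (Poly_Mapping.lookup q n when l = m) when k = n)"
      proof (rule Sum_any.cong)
        fix k
        show "(Poly_Mapping.lookup q k when m + n = l + k) =
            ((Poly_Mapping.lookup q n when l = m) when k = n)"
          using uniq[OF True, of k] by (auto simp: when_def in_keys_iff)
      qed
      then show ?thesis by (simp add: when_def)
    next
      case False
      then show ?thesis using m(1) by (auto simp: when_def in_keys_iff)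
    qed
  qed
  also have "\<dots> = Poly_Mapping.lookup p m * Poly_Mapping.lookup q n" by simp
  also have "\<dots> \<noteq> 0" using m(1) n(1) by (simp add: in_keys_iff)
  finally show ?thesis by auto
qed

typedef 'a zpoly = "UNIV :: (('a \<Rightarrow>\<^sub>0 nat) \<Rightarrow>\<^sub>0 int) set" ..

setup_lifting type_definition_zpoly

instantiation zpoly :: (type) idom
begin

lift_definition zero_zpoly :: "'a zpoly" is 0 .
lift_definition one_zpoly :: "'a zpoly" is 1 .
lift_definition plus_zpoly :: "'a zpoly \<Rightarrow> 'a zpoly \<Rightarrow> 'a zpoly" is "(+)" .
lift_definition minus_zpoly :: "'a zpoly \<Rightarrow> 'a zpoly \<Rightarrow> 'a zpoly" is "(-)" .
lift_definition uminus_zpoly :: "'a zpoly \<Rightarrow> 'a zpoly" is uminus .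
lift_definition times_zpoly :: "'a zpoly \<Rightarrow> 'a zpoly \<Rightarrow> 'a zpoly" is "(*)" .

instance
  by standard (transfer; simp add: algebra_simps poly_mapping_no_zero_divisors)+

end

lemma zpoly_fract_of_int_eq_iff: "(of_int k :: 'a zpoly fract) = of_int l \<longleftrightarrow> k = l"
proof -
  have rep_nat: "Rep_zpoly (of_nat n) = of_nat n" for n
    by (induction n) (simp_all add: zero_zpoly.rep_eq one_zpoly.rep_eq plus_zpoly.rep_eq)
  have rep_int: "Rep_zpoly (of_int k) = of_int k" for k
    by (cases k rule: int_diff_cases) (simp add: minus_zpoly.rep_eq rep_nat)
  have fract_nat: "(of_nat n :: 'a zpoly fract) = Fract (of_nat n) 1" for n
    by (rule of_nat_fract)
  have fract_int: "(of_int k :: 'a zpoly fract) = Fract (of_int k) 1" for k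
    by (cases k rule: int_diff_cases) (simp add: fract_nat)
  show ?thesis
    by (metis fract_int eq_fract(1) mult.right_neutral of_int_eq_iff rep_int zero_neq_one)
qed

lift_definition Var :: "'a \<Rightarrow> 'a zpoly"
  is "\<lambda>e. Poly_Mapping.single (Poly_Mapping.single e 1) 1" .


section \<open>The \<open>g\<close>-polynomial\<close>

definition elem_sym :: "nat \<Rightarrow> 'b::comm_ring_1 list \<Rightarrow> 'b" where
  "elem_sym k xs = (\<Sum>I | I \<subseteq> {..<length xs} \<and> card I = k. \<Prod>i\<in>I. xs ! i)"

text \<open>
  Total orderings of the ground set are lists without repetition; \<open>w ! k\<close> is \<open>w\<^bsub>k+1\<^esub>\<close>.
\<close>

definition greedy_basis :: "'a ranked_set \<Rightarrow> 'a list \<Rightarrow> 'a set" where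
  "greedy_basis M w =
     {w ! k | k. k < length w \<and> rk M (set (take k w)) < rk M (set (take (Suc k) w))}"

definition x_list :: "'a ranked_set \<Rightarrow> 'a list \<Rightarrow> 'a zpoly list" where
  "x_list M w = map Var (filter (\<lambda>e. e \<in> greedy_basis M w) w)"

definition y_list :: "'a ranked_set \<Rightarrow> 'a list \<Rightarrow> 'a zpoly list" where
  "y_list M w = map (\<lambda>e. - Var e) (filter (\<lambda>e. e \<notin> greedy_basis M w) (rev w))"

definition alpha :: "'a list \<Rightarrow> 'a zpoly" where
  "alpha w = - Var (last w)"

definition deg :: "'a set \<Rightarrow> ('a list \<Rightarrow> 'a zpoly) \<Rightarrow> 'a zpoly fract" where
  "deg E f = (\<Sum>w\<in>permutations_of_set E.
     Fract (f w) (\<Prod>i<card E - 1. Var (w ! i) - Var (w ! Suc i)))"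

text \<open>
  The degrees of the families used in \<open>g_poly\<close> are integer constants. Such an integer is unique
  because the field of fractions has characteristic zero.
\<close>

definition deg_int :: "'a set \<Rightarrow> ('a list \<Rightarrow> 'a zpoly) \<Rightarrow> int" where
  "deg_int E f = (THE k. deg E f = of_int k)"

lemma deg_int_eqI: "deg E f = of_int k \<Longrightarrow> deg_int E f = k"
  unfolding deg_int_def by (rule the_equality) (simp_all add: zpoly_fract_of_int_eq_iff)

definition g_poly :: "'a ranked_set \<Rightarrow> int poly" where
  "g_poly M =
     (if ground M = {} then 1
      else if \<exists>e. is_loop M e \<or> is_coloop M e then 0
      else
        let n = card (ground M); r = mrank M in
        (-1) ^ card (components M) *
        (\<Sum>i = 1..r. (- monom 1 1) ^ i *
           (\<Sum>j = 0..i - 1. of_int (deg_int (ground M) (\<lambda>w.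
              alpha w ^ j
              * elem_sym (i - j - 1) (map uminus (y_list M w))
              * elem_sym (r - i) (x_list M w)
              * elem_sym (n - r) (y_list M w))))))"

definition omega :: "'a ranked_set \<Rightarrow> int" where
  "omega M = coeff (g_poly M) (mrank M)"

end

theory Submission
  imports Defs
begin

text \<open>
  Expand the elementary symmetric functions one Chern root at a time. If an element \<open>b\<close> is contracted
  to a loop in a rank function, or deleted to a coloop in a nullity function, exactly one root is
  lost, and it differs from \<open>\<plusminus>z b\<close> by a sum of terms \<open>z\<^bsub>w k\<^esub> - z\<^bsub>w (k+1)\<^esub>\<close> with coefficients \<open>0\<close> or
  \<open>1\<close>. The constant \<open>\<plusminus>z b\<close> only contributes a degree of an integrand of too low order, which
  vanishes; each term \<open>z\<^bsub>w k\<^esub> - z\<^bsub>w (k+1)\<^esub>\<close> cancels a denominator, so that the degree becomes a sum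
  of products of degrees over an initial set \<open>S\<close> and over its complement. By induction all top
  degree products of Chern classes of dual tautological subbundles and of quotient bundles have
  nonnegative degree.

  Applied to the factor \<open>e\<^bsub>r-i\<^esub>(x)\<close> of the coefficient of \<open>t\<^sup>i\<close>, the same recursion leaves, on \<open>S\<close>, such
  a nonnegative degree, and on the complement the corresponding integrand of the contraction
  \<open>M / S\<close>. It ends with the leading coefficients \<open>\<omega>(M / F)\<close> for flats \<open>F\<close>, because a loop in \<open>M / S\<close>
  makes the degree vanish. Connectedness of \<open>M / F\<close> makes all signs \<open>(-1)\<^bsup>c(M / F)\<^esup>\<close> equal.
\<close>

section \<open>Elementary symmetric functions\<close>

text \<open>The coefficient of \<open>t^k\<close> in the product of the factors
  \<open>1 + g e * t\<close>. With roots indexed by a set, a disjoint union becomes a product of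
  polynomials, which is the form needed for the Whitney sum formula.\<close>

definition esym :: "('a \<Rightarrow> 'b::comm_ring_1) \<Rightarrow> nat \<Rightarrow> 'a set \<Rightarrow> 'b" where
  "esym g k X = coeff (\<Prod>e\<in>X. [:1, g e:]) k"

lemma esym_empty: "esym g k {} = of_bool (k = 0)"
  by (simp add: esym_def)

lemma esym_0 [simp]: "esym g 0 X = 1"
proof -
  have "coeff (\<Prod>e\<in>X. [:1, g e:]) 0 = (\<Prod>e\<in>X. coeff [:1, g e:] 0)"
    by (induction X rule: infinite_finite_induct) (simp_all add: coeff_mult)
  then show ?thesis by (simp add: esym_def)
qed

lemma esym_Suc_insert:
  assumes "finite X" "x \<notin> X"
  shows "esym g (Suc k) (insert x X) = esym g (Suc k) X + g x * esym g k X"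
  using assms by (simp add: esym_def)

lemma esym_Un:
  assumes "finite X" "finite Y" "X \<inter> Y = {}"
  shows "esym g k (X \<union> Y) = (\<Sum>i\<le>k. esym g i X * esym g (k - i) Y)"
  using assms by (simp add: esym_def prod.union_disjoint coeff_mult)

lemma esym_gt_card:
  assumes "finite X" "card X < k"
  shows "esym g k X = 0"
  using assms
proof (induction X arbitrary: k rule: finite_induct)
  case empty
  then show ?case by (simp add: esym_empty)
next
  case (insert x X)
  then obtain l where "k = Suc l" by (cases k) auto
  with insert show ?case by (simp add: esym_Suc_insert)
qed

lemma esym_card:
  assumes "finite X"
  shows "esym g (card X) X = (\<Prod>e\<in>X. g e)"
  using assms
  by (induction X rule: finite_induct) (simp_all add: esym_Suc_insert esym_gt_card)

text \<open>A subset either avoids the new element or contains it, and in the second case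
  contributes the factor \<open>g x\<close>; the coefficients of the product obey the same
  recursion.\<close>

lemma coeff_prod_linear:
  fixes g :: "'a \<Rightarrow> 'b::comm_ring_1"
  assumes "finite A"
  shows "coeff (\<Prod>i\<in>A. [:1, g i:]) k = (\<Sum>I | I \<subseteq> A \<and> card I = k. \<Prod>i\<in>I. g i)"
  using assms
proof (induction A arbitrary: k rule: finite_induct)
  case empty
  have "{I::'a set. I = {} \<and> card I = k} = (if k = 0 then {{}} else {})" by auto
  then show ?case by auto
next
  case (insert x A)
  show ?case
  proof (cases k)
    case 0
    have "{I. I \<subseteq> insert x A \<and> card I = 0} = {{}}"
      using insert.hyps by (auto simp: card_eq_0_iff dest: finite_subset)
    moreover have "{I. I \<subseteq> A \<and> card I = 0} = {{}}"
      using insert.hyps by (auto simp: card_eq_0_iff dest: finite_subset)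
    ultimately show ?thesis using insert 0 by simp
  next
    case (Suc l)
    have split: "{I. I \<subseteq> insert x A \<and> card I = Suc l} =
        {I. I \<subseteq> A \<and> card I = Suc l} \<union> insert x ` {I. I \<subseteq> A \<and> card I = l}"
      (is "?L = ?R1 \<union> ?R2")
    proof (intro equalityI subsetI)
      fix I assume I: "I \<in> ?L"
      show "I \<in> ?R1 \<union> ?R2"
      proof (cases "x \<in> I")
        case True
        then have "I = insert x (I - {x})" "card (I - {x}) = l" "I - {x} \<subseteq> A"
          using I by auto
        then show ?thesis by blast
      qed (use I in auto)
    next
      fix I assume "I \<in> ?R1 \<union> ?R2"
      then show "I \<in> ?L"
      proof
        assume "I \<in> ?R2"
        then obtain J where J: "I = insert x J" "J \<subseteq> A" "card J = l" by auto
        then have "finite J" "x \<notin> J" using insert.hyps finite_subset by auto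
        then show ?thesis using J by auto
      qed auto
    qed
    have "inj_on (insert x) {I. I \<subseteq> A \<and> card I = l}"
      using insert.hyps(2) by (auto simp: inj_on_def)
    moreover have "(\<Prod>i\<in>insert x I. g i) = g x * (\<Prod>i\<in>I. g i)" if "I \<subseteq> A" for I
      using that insert.hyps finite_subset by (subst prod.insert) auto
    moreover have "?R1 \<inter> ?R2 = {}" using insert.hyps(2) by auto
    ultimately have "(\<Sum>I\<in>?L. \<Prod>i\<in>I. g i) =
        (\<Sum>I\<in>?R1. \<Prod>i\<in>I. g i) + g x * (\<Sum>I | I \<subseteq> A \<and> card I = l. \<Prod>i\<in>I. g i)"
      unfolding split using insert.hyps(1)
      by (subst sum.union_disjoint) (auto simp: sum.reindex sum_distrib_left intro!: sum.cong)
    then show ?thesis using insert Suc by simp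
  qed
qed

text \<open>A list without repetition uses each root once, so the arrangement of
  \<open>x_list\<close> and \<open>y_list\<close> is immaterial.\<close>

lemma elem_sym_map:
  assumes "distinct xs"
  shows "elem_sym k (map g xs) = esym g k (set xs)"
proof -
  have "elem_sym k (map g xs) = coeff (\<Prod>i<length xs. [:1, map g xs ! i:]) k"
    unfolding elem_sym_def by (subst coeff_prod_linear) auto
  also have "(\<Prod>i<length xs. [:1, map g xs ! i:]) = (\<Prod>e\<in>set xs. [:1, g e:])"
    using prod.reindex_bij_betw[OF bij_betw_nth[OF assms refl refl], of "\<lambda>e. [:1, g e:]"] by simp
  finally show ?thesis by (simp add: esym_def)
qed


section \<open>Jumps of set functions along orderings\<close>

text \<open>For a rank function these are the elements of the greedy basis, for a nullity function
  those outside it. Admitting any set function treats both kinds of bundle, and their minors,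
  uniformly.\<close>

definition jumps :: "('a set \<Rightarrow> nat) \<Rightarrow> 'a list \<Rightarrow> 'a set" where
  "jumps \<rho> w = {w ! k | k. k < length w \<and> \<rho> (set (take k w)) < \<rho> (set (take (Suc k) w))}"

lemma jumps_Nil [simp]: "jumps \<rho> [] = {}"
  by (simp add: jumps_def)

lemma jumps_snoc:
  "jumps \<rho> (w @ [x]) =
     jumps \<rho> w \<union> (if \<rho> (set w) < \<rho> (insert x (set w)) then {x} else {})"
proof -
  have "jumps \<rho> (w @ [x]) =
      (\<lambda>k. (w @ [x]) ! k) ` {k. k < Suc (length w) \<and>
         \<rho> (set (take k (w @ [x]))) < \<rho> (set (take (Suc k) (w @ [x])))}"
    unfolding jumps_def by auto
  also have "{k. k < Suc (length w) \<and>
         \<rho> (set (take k (w @ [x]))) < \<rho> (set (take (Suc k) (w @ [x])))} =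
      {k. k < length w \<and> \<rho> (set (take k w)) < \<rho> (set (take (Suc k) w))} \<union>
      (if \<rho> (set w) < \<rho> (insert x (set w)) then {length w} else {})"
    by (auto simp: less_Suc_eq)
  also have "(\<lambda>k. (w @ [x]) ! k) ` \<dots> =
      jumps \<rho> w \<union> (if \<rho> (set w) < \<rho> (insert x (set w)) then {x} else {})"
    unfolding jumps_def image_Un by (auto simp: nth_append image_iff)
  finally show ?thesis .
qed

lemma jumps_subset: "jumps \<rho> w \<subseteq> set w"
  by (auto simp: jumps_def)

lemma finite_jumps [simp]: "finite (jumps \<rho> w)"
  by (rule finite_subset[OF jumps_subset]) simp

text \<open>After the prefix \<open>u\<close> only sets containing \<open>set u\<close> are met, so
  \<open>v\<close> sees the contraction of \<open>\<rho>\<close> by \<open>set u\<close>, up to an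
  additive constant.\<close>

lemma jumps_append: "jumps \<rho> (u @ v) = jumps \<rho> u \<union> jumps (\<lambda>A. \<rho> (set u \<union> A)) v"
proof (induction v rule: rev_induct)
  case (snoc x v)
  have "u @ v @ [x] = (u @ v) @ [x]" by simp
  then show ?case by (simp only: jumps_snoc snoc) auto
qed simp

lemma jumps_cong:
  assumes "set w \<subseteq> E"
    and "\<And>A x. A \<subseteq> E \<Longrightarrow> x \<in> E \<Longrightarrow> \<rho> A < \<rho> (insert x A) \<longleftrightarrow> \<rho>' A < \<rho>' (insert x A)"
  shows "jumps \<rho> w = jumps \<rho>' w"
  using assms(1) by (induction w rule: rev_induct) (auto simp: jumps_snoc assms(2))

lemma jumps_complement:
  assumes "distinct w" "set w \<subseteq> E"
    and "\<And>A x. A \<subseteq> E \<Longrightarrow> x \<in> E - A \<Longrightarrow> \<rho> A < \<rho> (insert x A) \<longleftrightarrow> \<not> \<rho>' A < \<rho>' (insert x A)"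
  shows "jumps \<rho> w = set w - jumps \<rho>' w"
  using assms(1,2)
proof (induction w rule: rev_induct)
  case (snoc x w)
  then show ?case using assms(3)[of "set w" x] jumps_subset[of \<rho>' w] by (auto simp: jumps_snoc)
qed simp

section \<open>Set functions with unit steps, and the sub- and supermodular ones among them\<close>

definition unit_step :: "'a set \<Rightarrow> ('a set \<Rightarrow> nat) \<Rightarrow> bool" where
  "unit_step E \<rho> \<longleftrightarrow>
     (\<forall>A x. A \<subseteq> E \<longrightarrow> x \<in> E \<longrightarrow> \<rho> A \<le> \<rho> (insert x A) \<and> \<rho> (insert x A) \<le> Suc (\<rho> A))"

lemma unit_stepD:
  assumes "unit_step E \<rho>" "A \<subseteq> E" "x \<in> E"
  shows "\<rho> A \<le> \<rho> (insert x A)" "\<rho> (insert x A) \<le> Suc (\<rho> A)"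
  using assms by (auto simp: unit_step_def)

text \<open>Every jump adds one, so the count telescopes. The term \<open>\<rho> {}\<close> stays
  because contraction is encoded as a shift without normalisation.\<close>

lemma card_jumps:
  assumes "unit_step E \<rho>" "distinct w" "set w \<subseteq> E"
  shows "\<rho> {} + card (jumps \<rho> w) = \<rho> (set w)"
  using assms(2,3)
proof (induction w rule: rev_induct)
  case (snoc x w)
  then have "x \<notin> jumps \<rho> w" using jumps_subset[of \<rho> w] by auto
  then show ?case using snoc unit_stepD[OF assms(1), of "set w" x] by (auto simp: jumps_snoc)
qed simp

text \<open>
  The number \<open>\<sigma>\<close> is the sign with which the elements of \<open>jumps \<rho> w\<close> enter: \<open>+1\<close> for a rank function,
  giving the Chern roots of the dual tautological subbundle, and \<open>-1\<close> for a nullity function,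
  giving those of the tautological quotient bundle.
\<close>

definition tame :: "'a set \<Rightarrow> 'k::ring_1 \<Rightarrow> ('a set \<Rightarrow> nat) \<Rightarrow> bool" where
  "tame E \<sigma> \<rho> \<longleftrightarrow> unit_step E \<rho> \<and>
     (\<sigma> = 1 \<and> (\<forall>A B. A \<subseteq> E \<longrightarrow> B \<subseteq> E \<longrightarrow> \<rho> (A \<union> B) + \<rho> (A \<inter> B) \<le> \<rho> A + \<rho> B) \<or>
      \<sigma> = -1 \<and> (\<forall>A B. A \<subseteq> E \<longrightarrow> B \<subseteq> E \<longrightarrow> \<rho> A + \<rho> B \<le> \<rho> (A \<union> B) + \<rho> (A \<inter> B)))"

lemma tame_unit_step: "tame E \<sigma> \<rho> \<Longrightarrow> unit_step E \<rho>"
  by (simp add: tame_def)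

text \<open>A map preserving unions and intersections carries over the sub- or supermodular
  inequality; only the unit steps need a separate check. The instances are restriction, adjoining a
  fixed set, and removing an element.\<close>

lemma tame_pullback:
  assumes "tame E \<sigma> \<rho>" "unit_step T (\<lambda>A. \<rho> (h A))"
    and "\<And>A. A \<subseteq> T \<Longrightarrow> h A \<subseteq> E"
    and h: "\<And>A B. h (A \<union> B) = h A \<union> h B" "\<And>A B. h (A \<inter> B) = h A \<inter> h B"
  shows "tame T \<sigma> (\<lambda>A. \<rho> (h A))"
proof -
  consider "\<sigma> = 1" "\<forall>A B. A \<subseteq> E \<longrightarrow> B \<subseteq> E \<longrightarrow> \<rho> (A \<union> B) + \<rho> (A \<inter> B) \<le> \<rho> A + \<rho> B"
    | "\<sigma> = -1" "\<forall>A B. A \<subseteq> E \<longrightarrow> B \<subseteq> E \<longrightarrow> \<rho> A + \<rho> B \<le> \<rho> (A \<union> B) + \<rho> (A \<inter> B)"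
    using assms(1) unfolding tame_def by blast
  then show ?thesis
  proof cases
    case 1
    then have "\<forall>A B. A \<subseteq> T \<longrightarrow> B \<subseteq> T \<longrightarrow>
        \<rho> (h (A \<union> B)) + \<rho> (h (A \<inter> B)) \<le> \<rho> (h A) + \<rho> (h B)"
      using assms(3) unfolding h by blast
    then show ?thesis using 1 assms(2) unfolding tame_def by blast
  next
    case 2
    then have "\<forall>A B. A \<subseteq> T \<longrightarrow> B \<subseteq> T \<longrightarrow>
        \<rho> (h A) + \<rho> (h B) \<le> \<rho> (h (A \<union> B)) + \<rho> (h (A \<inter> B))"
      using assms(3) unfolding h by blast
    then show ?thesis using 2 assms(2) unfolding tame_def by blast
  qed
qed

lemma tame_subset:
  assumes "tame E \<sigma> \<rho>" "S \<subseteq> E"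
  shows "tame S \<sigma> \<rho>"
proof -
  have "unit_step S \<rho>"
    using tame_unit_step[OF assms(1)] assms(2) unfolding unit_step_def by (meson order_trans subsetD)
  then show ?thesis using tame_pullback[OF assms(1), of S "\<lambda>A. A"] assms(2) by auto
qed

lemma tame_shift:
  assumes "tame E \<sigma> \<rho>" "S \<subseteq> E" "T \<subseteq> E"
  shows "tame T \<sigma> (\<lambda>A. \<rho> (S \<union> A))"
proof (rule tame_pullback[OF assms(1)])
  show "unit_step T (\<lambda>A. \<rho> (S \<union> A))"
    unfolding unit_step_def
  proof (intro allI impI)
    fix A x assume "A \<subseteq> T" "x \<in> T"
    then have "S \<union> A \<subseteq> E" "x \<in> E" using assms by auto
    then show "\<rho> (S \<union> A) \<le> \<rho> (S \<union> insert x A) \<and> \<rho> (S \<union> insert x A) \<le> Suc (\<rho> (S \<union> A))"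
      using unit_stepD[OF tame_unit_step[OF assms(1)]] by simp
  qed
qed (use assms in auto)

lemma tame_insert:
  assumes "tame E \<sigma> \<rho>" "b \<in> E"
  shows "tame E \<sigma> (\<lambda>A. \<rho> (insert b A))"
  using tame_shift[OF assms(1), of "{b}" E] assms(2) by simp

lemma tame_remove:
  assumes "tame E \<sigma> \<rho>"
  shows "tame E \<sigma> (\<lambda>A. \<rho> (A - {b}))"
proof (rule tame_pullback[OF assms])
  show "unit_step E (\<lambda>A. \<rho> (A - {b}))"
    unfolding unit_step_def
  proof (intro allI impI)
    fix A x assume Ax: "A \<subseteq> E" "x \<in> E"
    then have "A - {b} \<subseteq> E" by auto
    with Ax show "\<rho> (A - {b}) \<le> \<rho> (insert x A - {b}) \<and> \<rho> (insert x A - {b}) \<le> Suc (\<rho> (A - {b}))"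
      using unit_stepD[OF tame_unit_step[OF assms], of "A - {b}" x]
      by (cases "x = b") (auto simp: insert_Diff_if)
  qed
qed auto

text \<open>Along \<open>w\<close> the monotone condition \<open>\<delta>\<close> switches on at
  most once. Away from the switch both functions change alike; the element \<open>\<phi>\<close> at
  the switch is the one extra jump. The constant \<open>m\<close> allows for the missing
  normalisation after a contraction.\<close>

lemma jumps_exchange_aux:
  assumes "unit_step E \<rho>" "unit_step E \<rho>'"
    and eq: "\<And>A. A \<subseteq> E \<Longrightarrow> \<rho> A + m = \<rho>' A + of_bool (\<delta> A)"
    and mono: "\<And>A x. A \<subseteq> E \<Longrightarrow> x \<in> E \<Longrightarrow> \<delta> A \<Longrightarrow> \<delta> (insert x A)"
    and "\<not> \<delta> {}"
    and "distinct w" "set w \<subseteq> E"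
  shows "if \<delta> (set w)
    then \<exists>\<phi>\<in>set w. jumps \<rho> w = insert \<phi> (jumps \<rho>' w) \<and> \<phi> \<notin> jumps \<rho>' w \<and>
           (\<forall>k\<le>length w. \<delta> (set (take k w)) \<longleftrightarrow> \<phi> \<in> set (take k w))
    else jumps \<rho> w = jumps \<rho>' w \<and> (\<forall>k\<le>length w. \<not> \<delta> (set (take k w)))"
  using assms(6,7)
proof (induction w rule: rev_induct)
  case Nil
  then show ?case using assms(5) by simp
next
  case (snoc x w)
  have w: "x \<notin> set w" "distinct w" "set w \<subseteq> E" "x \<in> E" "insert x (set w) \<subseteq> E"
    using snoc.prems by auto
  note IH = snoc.IH[OF w(2,3)]
  note e = eq[OF w(3)] eq[OF w(5)]
  note u = unit_stepD[OF assms(1) w(3,4)] unit_stepD[OF assms(2) w(3,4)]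
  have sub: "jumps \<rho>' w \<subseteq> set w" by (rule jumps_subset)
  have take: "set (take k (w @ [x])) = (if k \<le> length w then set (take k w) else insert x (set w))"
    if "k \<le> length (w @ [x])" for k using that by auto
  consider "\<delta> (set w)" | "\<not> \<delta> (set w)" "\<delta> (insert x (set w))" | "\<not> \<delta> (insert x (set w))"
    by blast
  then show ?case
  proof cases
    case 1
    then have d: "\<delta> (insert x (set w))" using mono w by blast
    from 1 IH obtain \<phi> where p: "\<phi> \<in> set w" "jumps \<rho> w = insert \<phi> (jumps \<rho>' w)" "\<phi> \<notin> jumps \<rho>' w"
      "\<forall>k\<le>length w. \<delta> (set (take k w)) \<longleftrightarrow> \<phi> \<in> set (take k w)" by auto
    have j: "\<rho> (set w) < \<rho> (insert x (set w)) \<longleftrightarrow> \<rho>' (set w) < \<rho>' (insert x (set w))"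
      using e 1 d by auto
    have "jumps \<rho> (w @ [x]) = insert \<phi> (jumps \<rho>' (w @ [x])) \<and> \<phi> \<notin> jumps \<rho>' (w @ [x]) \<and>
        (\<forall>k\<le>length (w @ [x]). \<delta> (set (take k (w @ [x]))) \<longleftrightarrow> \<phi> \<in> set (take k (w @ [x])))"
      using p w d by (auto simp: jumps_snoc j take simp del: take_append)
    moreover have "\<phi> \<in> set (w @ [x])" using p by simp
    ultimately show ?thesis using d by auto
  next
    case 2
    then have p: "jumps \<rho> w = jumps \<rho>' w" "\<forall>k\<le>length w. \<not> \<delta> (set (take k w))" using IH by auto
    \<comment> \<open>Across the switch \<open>\<rho>\<close> gains one more than
      \<open>\<rho>'\<close>; unit steps then force a jump of \<open>\<rho>\<close> and none of
      \<open>\<rho>'\<close>.\<close>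
    have "\<rho> (set w) < \<rho> (insert x (set w))" "\<not> \<rho>' (set w) < \<rho>' (insert x (set w))"
      using e u 2 by auto
    then have "jumps \<rho> (w @ [x]) = insert x (jumps \<rho>' (w @ [x])) \<and> x \<notin> jumps \<rho>' (w @ [x]) \<and>
        (\<forall>k\<le>length (w @ [x]). \<delta> (set (take k (w @ [x]))) \<longleftrightarrow> x \<in> set (take k (w @ [x])))"
      using p w sub 2 by (auto simp: jumps_snoc take simp del: take_append dest: in_set_takeD)
    then show ?thesis using 2 by auto
  next
    case 3
    then have d: "\<not> \<delta> (set w)" using mono w by blast
    then have p: "jumps \<rho> w = jumps \<rho>' w" "\<forall>k\<le>length w. \<not> \<delta> (set (take k w))" using IH by auto
    have "\<rho> (set w) < \<rho> (insert x (set w)) \<longleftrightarrow> \<rho>' (set w) < \<rho>' (insert x (set w))"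
      using e 3 d by auto
    then show ?thesis using p 3 by (auto simp: jumps_snoc take simp del: take_append)
  qed
qed

lemma jumps_exchange:
  assumes "unit_step E \<rho>" "unit_step E \<rho>'"
    and "\<And>A. A \<subseteq> E \<Longrightarrow> \<rho> A + m = \<rho>' A + of_bool (\<delta> A)"
    and "\<And>A x. A \<subseteq> E \<Longrightarrow> x \<in> E \<Longrightarrow> \<delta> A \<Longrightarrow> \<delta> (insert x A)"
    and "\<not> \<delta> {}" "\<delta> (set w)"
    and "distinct w" "set w \<subseteq> E"
  obtains \<phi> where "\<phi> \<in> set w" "jumps \<rho> w = insert \<phi> (jumps \<rho>' w)" "\<phi> \<notin> jumps \<rho>' w"
    "\<And>k. k \<le> length w \<Longrightarrow> \<delta> (set (take k w)) \<longleftrightarrow> \<phi> \<in> set (take k w)"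
  using jumps_exchange_aux[OF assms(1-5,7,8)] assms(6) by auto

section \<open>Degrees by localization\<close>

lemma finite_length_permutations_of_set:
  assumes "w \<in> permutations_of_set E"
  shows "set w = E" "distinct w" "length w = card E"
  using assms by (auto simp: permutations_of_set_def distinct_card)

locale weights =
  fixes z :: "'a \<Rightarrow> 'k::field"
  assumes inj_z: "inj z"
begin

text \<open>Orderings index the torus-fixed points of the permutohedral variety, and this is the
  product of the tangent weights there. For at most one element the product is empty, hence
  1.\<close>

definition den :: "'a list \<Rightarrow> 'k" where
  "den w = (\<Prod>i<length w - 1. z (w ! i) - z (w ! Suc i))"

definition degree_sum :: "'a set \<Rightarrow> ('a list \<Rightarrow> 'k) \<Rightarrow> 'k" where
  "degree_sum E f = (\<Sum>w\<in>permutations_of_set E. f w / den w)"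

text \<open>Localization on a product of two permutohedral varieties, the shape of the boundary
  divisor attached to a proper nonempty set.\<close>

definition degree_sum2 :: "'a set \<Rightarrow> 'a set \<Rightarrow> ('a list \<Rightarrow> 'a list \<Rightarrow> 'k) \<Rightarrow> 'k" where
  "degree_sum2 S T F =
     (\<Sum>u\<in>permutations_of_set S. \<Sum>v\<in>permutations_of_set T. F u v / (den u * den v))"

lemma degree_sum_cong:
  "(\<And>w. w \<in> permutations_of_set E \<Longrightarrow> f w = g w) \<Longrightarrow> degree_sum E f = degree_sum E g"
  by (simp add: degree_sum_def)

lemma degree_sum_add: "degree_sum E (\<lambda>w. f w + g w) = degree_sum E f + degree_sum E g"
  by (simp add: degree_sum_def add_divide_distrib sum.distrib)

lemma degree_sum_cmult: "degree_sum E (\<lambda>w. c * f w) = c * degree_sum E f"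
  by (simp add: degree_sum_def sum_distrib_left)

lemma degree_sum_sum: "degree_sum E (\<lambda>w. \<Sum>i\<in>I. f i w) = (\<Sum>i\<in>I. degree_sum E (f i))"
  unfolding degree_sum_def sum_divide_distrib by (rule sum.swap)

lemma degree_sum2_cong:
  "(\<And>u v. u \<in> permutations_of_set S \<Longrightarrow> v \<in> permutations_of_set T \<Longrightarrow> F u v = G u v) \<Longrightarrow>
     degree_sum2 S T F = degree_sum2 S T G"
  by (simp add: degree_sum2_def)

lemma degree_sum2_add:
  "degree_sum2 S T (\<lambda>u v. F u v + G u v) = degree_sum2 S T F + degree_sum2 S T G"
  by (simp add: degree_sum2_def add_divide_distrib sum.distrib)

lemma degree_sum2_sum:
  assumes "finite I"
  shows "degree_sum2 S T (\<lambda>u v. \<Sum>i\<in>I. F i u v) = (\<Sum>i\<in>I. degree_sum2 S T (F i))"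
  using assms
proof (induction I rule: finite_induct)
  case empty
  then show ?case by (simp add: degree_sum2_def)
next
  case (insert i I)
  then show ?case by (simp add: degree_sum2_add)
qed

lemma degree_sum2_tensor:
  "degree_sum2 S T (\<lambda>u v. p u * q v) = degree_sum S p * degree_sum T q"
  by (simp add: degree_sum2_def degree_sum_def sum_product)

lemma den_append:
  assumes "u \<noteq> []" "v \<noteq> []"
  shows "den (u @ v) = den u * (z (last u) - z (hd v)) * den v"
proof -
  let ?g = "\<lambda>i. z ((u @ v) ! i) - z ((u @ v) ! Suc i)"
  obtain m where m: "length u = Suc m" using assms by (cases u) auto
  obtain l where l: "length v = Suc l" using assms by (cases v) auto
  have "{..<length (u @ v) - 1} = {..<Suc m} \<union> {Suc m..<Suc m + l}"
    using m l by auto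
  then have "den (u @ v) = (\<Prod>i\<in>{..<Suc m} \<union> {Suc m..<Suc m + l}. ?g i)"
    unfolding den_def by (simp only:)
  also have "\<dots> = (\<Prod>i<Suc m. ?g i) * (\<Prod>i\<in>{Suc m..<Suc m + l}. ?g i)"
    by (rule prod.union_disjoint) auto
  also have "(\<Prod>i<Suc m. ?g i) = (\<Prod>i<m. ?g i) * ?g m"
    by (rule prod.lessThan_Suc)
  also have "(\<Prod>i<m. ?g i) = den u"
    unfolding den_def using m by (intro prod.cong) (auto simp: nth_append)
  also have "?g m = z (last u) - z (hd v)"
    using m assms by (simp add: nth_append last_conv_nth hd_conv_nth)
  also have "(\<Prod>i\<in>{Suc m..<Suc m + l}. ?g i) = den v"
    unfolding den_def using m l
    by (intro prod.reindex_bij_witness[of _ "\<lambda>i. i + Suc m" "\<lambda>i. i - Suc m"])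
       (auto simp: nth_append Suc_diff_le simp flip: Suc_diff_Suc)
  finally show ?thesis .
qed

text \<open>
  The factor cancels one denominator at a time, which splits every ordering into an ordering of an
  initial set \<open>S\<close> and one of its complement: the restriction to the divisor of \<open>S\<close>.
\<close>

lemma degree_sum_divisor:
  assumes "finite E"
  shows "degree_sum E (\<lambda>w. (\<Sum>k<card E - 1. of_bool (c (set (take (Suc k) w))) *
            (z (w ! k) - z (w ! Suc k))) * f w) =
         (\<Sum>S | S \<subset> E \<and> S \<noteq> {} \<and> c S. degree_sum2 S (E - S) (\<lambda>u v. f (u @ v)))"
proof -
  let ?P = permutations_of_set
  let ?A = "Sigma (?P E) (\<lambda>w. {k. k < card E - 1 \<and> c (set (take (Suc k) w))})"
  let ?B = "Sigma {S. S \<subset> E \<and> S \<noteq> {} \<and> c S} (\<lambda>S. ?P S \<times> ?P (E - S))"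
  have fS: "finite {S. S \<subset> E \<and> S \<noteq> {} \<and> c S}"
    by (rule finite_subset[of _ "Pow E"]) (use assms in auto)
  have eq: "(z (w ! k) - z (w ! Suc k)) * f w / den w =
      f w / (den (take (Suc k) w) * den (drop (Suc k) w))"
    if "w \<in> ?P E" "k < card E - 1" for w k
  proof -
    note w = finite_length_permutations_of_set[OF that(1)]
    have k: "Suc k < length w" using that(2) w by simp
    then have ne: "take (Suc k) w \<noteq> []" "drop (Suc k) w \<noteq> []" by auto
    have "last (take (Suc k) w) = w ! k" "hd (drop (Suc k) w) = w ! Suc k"
      using k by (simp_all add: take_Suc_conv_app_nth hd_drop_conv_nth)
    then have d: "den w = den (take (Suc k) w) * (z (w ! k) - z (w ! Suc k)) * den (drop (Suc k) w)"
      using den_append[OF ne] by simp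
    have "w ! k \<noteq> w ! Suc k" using w(2) k by (simp add: nth_eq_iff_index_eq)
    then have "z (w ! k) - z (w ! Suc k) \<noteq> 0" using inj_z by (auto dest: injD)
    then show ?thesis unfolding d by (simp add: mult.commute mult.left_commute)
  qed
  have "degree_sum E (\<lambda>w. (\<Sum>k<card E - 1. of_bool (c (set (take (Suc k) w))) *
            (z (w ! k) - z (w ! Suc k))) * f w) =
      (\<Sum>w\<in>?P E. \<Sum>k<card E - 1. of_bool (c (set (take (Suc k) w))) *
            ((z (w ! k) - z (w ! Suc k)) * f w / den w))"
    unfolding degree_sum_def sum_distrib_right sum_divide_distrib
    by (simp only: mult.assoc times_divide_eq_right)
  also have "\<dots> = (\<Sum>w\<in>?P E. \<Sum>k<card E - 1. of_bool (c (set (take (Suc k) w))) *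
            (f w / (den (take (Suc k) w) * den (drop (Suc k) w))))"
    by (intro sum.cong refl) (simp add: eq)
  also have "\<dots> = (\<Sum>w\<in>?P E. \<Sum>k | k < card E - 1 \<and> c (set (take (Suc k) w)).
            f w / (den (take (Suc k) w) * den (drop (Suc k) w)))"
    by (intro sum.cong refl sum.mono_neutral_cong_right) auto
  also have "\<dots> = (\<Sum>(w, k)\<in>?A. f w / (den (take (Suc k) w) * den (drop (Suc k) w)))"
    by (rule sum.Sigma) auto
  also have "\<dots> = (\<Sum>(S, u, v)\<in>?B. f (u @ v) / (den u * den v))"
  \<comment> \<open>An ordering with a chosen cut is the same as an initial set with orderings of
    both sides. The cut index is \<open>card S - 1\<close> because the prefix has length
    \<open>Suc k\<close>.\<close>
  proof (rule sum.reindex_bij_witness[of _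
        "\<lambda>(S, u, v). (u @ v, card S - 1)"
        "\<lambda>(w, k). (set (take (Suc k) w), take (Suc k) w, drop (Suc k) w)"], goal_cases)
    case (1 a)
    then obtain w k where a: "a = (w, k)" "w \<in> ?P E" "k < card E - 1" by auto
    note w = finite_length_permutations_of_set[OF a(2)]
    have "card (set (take (Suc k) w)) = Suc k"
      using w a(3) by (simp add: distinct_card)
    then show ?case using a by simp
  next
    case (2 a)
    then obtain w k where a: "a = (w, k)" "w \<in> ?P E" "k < card E - 1" "c (set (take (Suc k) w))"
      by auto
    note w = finite_length_permutations_of_set[OF a(2)]
    have disj: "set (take (Suc k) w) \<inter> set (drop (Suc k) w) = {}"
      using w(2) by (rule set_take_disj_set_drop_if_distinct) simp
    have un: "set (take (Suc k) w) \<union> set (drop (Suc k) w) = E"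
      unfolding set_append[symmetric] append_take_drop_id by (rule w(1))
    have compl: "A \<subset> E \<and> B = E - A" if "A \<inter> B = {}" "A \<union> B = E" "B \<noteq> {}" for A B :: "'a set"
      using that by auto
    have "set (drop (Suc k) w) \<noteq> {}" using a(3) w(3) by simp
    then have c: "set (take (Suc k) w) \<subset> E" "set (drop (Suc k) w) = E - set (take (Suc k) w)"
      using compl[OF disj un] by auto
    have ne: "set (take (Suc k) w) \<noteq> {}" using a(3) w(3) by (auto simp: take_eq_Nil)
    have "take (Suc k) w \<in> ?P (set (take (Suc k) w))"
      "drop (Suc k) w \<in> ?P (E - set (take (Suc k) w))"
      using w(2) c(2) by (auto simp: permutations_of_set_def)
    then show ?case using c(1) ne a(4) unfolding a(1) by simp
  next
    case (3 b)
    then obtain S u v where b: "b = (S, u, v)" "S \<subset> E" "S \<noteq> {}" "u \<in> ?P S" "v \<in> ?P (E - S)"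
      by auto
    note u = finite_length_permutations_of_set[OF b(4)]
    have "card S > 0" using b assms by (auto simp: card_gt_0_iff dest: finite_subset)
    then have "Suc (card S - 1) = length u" using u by simp
    then show ?case using b u by simp
  next
    case (4 b)
    then obtain S u v where b: "b = (S, u, v)" "S \<subset> E" "S \<noteq> {}" "c S"
      "u \<in> ?P S" "v \<in> ?P (E - S)"
      by auto
    note u = finite_length_permutations_of_set[OF b(5)]
    note v = finite_length_permutations_of_set[OF b(6)]
    have "card S > 0" using b assms by (auto simp: card_gt_0_iff dest: finite_subset)
    moreover have "card S < card E" using b assms by (simp add: psubset_card_mono)
    moreover have "u @ v \<in> ?P E" using u v b(2) by (auto simp: permutations_of_set_def)
    ultimately show ?case using b u by auto
  next
    case (5 a)
    then show ?case by (auto)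
  qed
  also have "\<dots> = (\<Sum>S | S \<subset> E \<and> S \<noteq> {} \<and> c S. \<Sum>(u, v)\<in>?P S \<times> ?P (E - S).
      f (u @ v) / (den u * den v))"
    using fS by (subst sum.Sigma) (auto simp: case_prod_unfold)
  also have "\<dots> = (\<Sum>S | S \<subset> E \<and> S \<noteq> {} \<and> c S. degree_sum2 S (E - S) (\<lambda>u v. f (u @ v)))"
    by (simp add: degree_sum2_def sum.cartesian_product)
  finally show ?thesis .
qed

text \<open>The prefixes containing \<open>e\<close> begin at its position, so exactly the
  differences from there on survive. This expresses differences of Chern roots by boundary
  divisors.\<close>

lemma telescope_prefix:
  assumes "distinct w" "e \<in> set w"
  shows "(\<Sum>k<length w - 1. of_bool (e \<in> set (take (Suc k) w)) * (z (w ! k) - z (w ! Suc k))) =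
     z e - z (last w)"
  using assms
proof (induction w rule: rev_induct)
  case (snoc x w)
  let ?t = "\<lambda>w k. of_bool (e \<in> set (take (Suc k) w)) * (z (w ! k) - z (w ! Suc k))"
  show ?case
  proof (cases "e \<in> set w")
    case True
    then obtain m where m: "length w = Suc m" by (cases w) auto
    have "(\<Sum>k<length (w @ [x]) - 1. ?t (w @ [x]) k) =
        (\<Sum>k<m. ?t (w @ [x]) k) + ?t (w @ [x]) m"
      using m by simp
    also have "(\<Sum>k<m. ?t (w @ [x]) k) = (\<Sum>k<length w - 1. ?t w k)"
      using m by (intro sum.cong) (auto simp: nth_append)
    also have "?t (w @ [x]) m = z (last w) - z x"
      using True m by (cases w rule: rev_cases) (auto simp: nth_append)
    also have "(\<Sum>k<length w - 1. ?t w k) = z e - z (last w)"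
      using snoc True by simp
    finally show ?thesis by simp
  next
    case False
    then have "e \<notin> set (take (Suc k) (w @ [x]))" if "k < length w" for k
      using that by (auto dest: in_set_takeD)
    then have "(\<Sum>k<length (w @ [x]) - 1. ?t (w @ [x]) k) = 0"
      by (intro sum.neutral) auto
    then show ?thesis using snoc.prems False by simp
  qed
qed simp

text \<open>Multiply by \<open>z b - z d\<close> for two distinct elements and write this factor as
  a difference of boundary divisors. By induction both divisors have the same degree, so the product
  is 0, and \<open>z b - z d\<close> can be cancelled.\<close>

lemma degree_sum_one:
  assumes "finite E" "2 \<le> card E"
  shows "degree_sum E (\<lambda>w. 1) = 0"
  using assms
proof (induction "card E" arbitrary: E rule: less_induct)
  case less
  obtain b where b: "b \<in> E" using less.prems by fastforce
  have "card (E - {b}) \<noteq> 0" using less.prems b by simp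
  then obtain d where d: "d \<in> E" "d \<noteq> b" by (auto simp: card_eq_0_iff)
  let ?diff = "\<lambda>c. \<lambda>w. \<Sum>k<card E - 1. of_bool (c (set (take (Suc k) w))) *
            (z (w ! k) - z (w ! Suc k))"
  let ?val = "\<lambda>S. degree_sum2 S (E - S) (\<lambda>u v. 1)"
  let ?in = "\<lambda>b d S. b \<in> S \<and> d \<notin> S"
  \<comment> \<open>By induction the degree of 1 on a side vanishes unless that side is a single
    element.\<close>
  have val: "?val S = of_bool (card S = 1 \<and> card (E - S) = 1)" if S: "S \<subset> E" "S \<noteq> {}" for S
  proof -
    have fin: "finite S" "finite (E - S)" using S less.prems finite_subset by auto
    have lt: "card S < card E" "card (E - S) < card E"
      using S less.prems by (auto intro!: psubset_card_mono)
    have pos: "card S \<noteq> 0" "card (E - S) \<noteq> 0" using S fin by auto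
    have 1: "degree_sum T (\<lambda>w. 1) = 1" if "card T = 1" for T
    proof -
      obtain t where "T = {t}" using \<open>card T = 1\<close> card_1_singletonE by blast
      then show ?thesis by (simp add: degree_sum_def den_def)
    qed
    have "?val S = degree_sum S (\<lambda>w. 1) * degree_sum (E - S) (\<lambda>w. 1)"
      using degree_sum2_tensor[of S "E - S" "\<lambda>_. 1" "\<lambda>_. 1"] by simp
    moreover have "degree_sum S (\<lambda>w. 1) = of_bool (card S = 1)"
      using less.hyps[OF lt(1) fin(1)] pos 1 by (cases "card S = 1") auto
    moreover have "degree_sum (E - S) (\<lambda>w. 1) = of_bool (card (E - S) = 1)"
      using less.hyps[OF lt(2) fin(2)] pos 1 by (cases "card (E - S) = 1") auto
    ultimately show ?thesis by simp
  qed
  have sum: "degree_sum E (?diff (?in b d)) = of_bool (card E = 2)"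
    if "b \<in> E" "d \<in> E" "d \<noteq> b" for b d
  proof -
    have "degree_sum E (?diff (?in b d)) =
        (\<Sum>S | S \<subset> E \<and> S \<noteq> {} \<and> ?in b d S. ?val S)"
      using degree_sum_divisor[OF less.prems(1), of "?in b d" "\<lambda>_. 1"] by simp
    also have "\<dots> = (\<Sum>S\<in>{{b}}. of_bool (card E = 2))"
    proof (rule sum.mono_neutral_cong)
      show "?val S = 0" if "S \<in> {S. S \<subset> E \<and> S \<noteq> {} \<and> ?in b d S} - {{b}}" for S
      proof -
        have "card S \<noteq> 1" using that by (auto simp: card_1_singleton_iff)
        then show ?thesis using that val by simp
      qed
      show "(of_bool (card E = 2) :: 'k) = 0" if "S \<in> {{b}} - {S. S \<subset> E \<and> S \<noteq> {} \<and> ?in b d S}" for S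
        using that \<open>b \<in> E\<close> \<open>d \<in> E\<close> \<open>d \<noteq> b\<close> by auto
      show "?val S = of_bool (card E = 2)"
        if "S \<in> {S. S \<subset> E \<and> S \<noteq> {} \<and> ?in b d S} \<inter> {{b}}" for S
      proof -
        have "card (E - {b}) = card E - 1" using \<open>b \<in> E\<close> by (rule card_Diff_singleton)
        then have c: "card (E - {b}) = 1 \<longleftrightarrow> card E = 2" using less.prems(2) by linarith
        have S: "S = {b}" "S \<subset> E" "S \<noteq> {}" using that by auto
        have "card S = 1" using S(1) by simp
        then show ?thesis using val[OF S(2,3)] c unfolding S(1) by simp
      qed
      show "finite {S. S \<subset> E \<and> S \<noteq> {} \<and> ?in b d S}"
        by (rule finite_subset[of _ "Pow E"]) (use less.prems in auto)
    qed simp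
    finally show ?thesis by simp
  qed
  have "(z b - z d) * degree_sum E (\<lambda>w. 1) = degree_sum E (\<lambda>w. (z b - z d) * 1)"
    by (rule degree_sum_cmult[symmetric])
  also have "\<dots> = degree_sum E (\<lambda>w. ?diff (?in b d) w + (-1) * ?diff (?in d b) w)"
  proof (rule degree_sum_cong)
    fix w assume w: "w \<in> permutations_of_set E"
    note w' = finite_length_permutations_of_set[OF w]
    have "z b - z d = (z b - z (last w)) - (z d - z (last w))" by simp
    also have "\<dots> = ?diff (\<lambda>S. b \<in> S) w - ?diff (\<lambda>S. d \<in> S) w"
      using telescope_prefix[OF w'(2), of b] telescope_prefix[OF w'(2), of d] w' b d by simp
    \<comment> \<open>Prefixes containing both elements cancel.\<close>
    also have "\<dots> = ?diff (?in b d) w - ?diff (?in d b) w"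
      unfolding sum_subtractf[symmetric] by (intro sum.cong) auto
    finally show "(z b - z d) * 1 = ?diff (?in b d) w + (-1) * ?diff (?in d b) w" by simp
  qed
  also have "\<dots> = 0"
    unfolding degree_sum_add degree_sum_cmult using sum b d by simp
  finally show ?case using d(2) inj_z by (auto dest: injD)
qed

end

section \<open>Products of nef tautological classes\<close>

context weights
begin

definition sym :: "'k \<Rightarrow> nat \<Rightarrow> 'a set \<Rightarrow> 'k" where
  "sym \<sigma> = esym (\<lambda>e. \<sigma> * z e)"

text \<open>The equivariant class, at the fixed point \<open>w\<close>, of the sum of the boundary
  divisors attached to the sets satisfying \<open>c\<close>; those through this fixed point belong
  to the proper prefixes of \<open>w\<close>.\<close>

definition divisor :: "('a set \<Rightarrow> bool) \<Rightarrow> 'a list \<Rightarrow> 'k" where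
  "divisor c w = (\<Sum>k<length w - 1. of_bool (c (set (take (Suc k) w))) *
     (z (w ! k) - z (w ! Suc k)))"

lemma degree_sum_divisor':
  assumes "finite E"
  shows "degree_sum E (\<lambda>w. divisor c w * f w) =
         (\<Sum>S | S \<subset> E \<and> S \<noteq> {} \<and> c S. degree_sum2 S (E - S) (\<lambda>u v. f (u @ v)))"
proof -
  have "degree_sum E (\<lambda>w. divisor c w * f w) =
      degree_sum E (\<lambda>w. (\<Sum>k<card E - 1. of_bool (c (set (take (Suc k) w))) *
            (z (w ! k) - z (w ! Suc k))) * f w)"
    by (rule degree_sum_cong)
       (simp only: divisor_def finite_length_permutations_of_set(3))
  then show ?thesis by (simp only: degree_sum_divisor[OF assms])
qed

text \<open>The sets \<open>jumps \<rho> w\<close> and \<open>jumps \<rho>' w\<close> differ by one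
  element \<open>\<phi>\<close>. As \<open>\<delta>\<close> holds exactly on the prefixes containing
  \<open>\<phi>\<close>, telescoping for \<open>\<phi>\<close> and for \<open>b\<close> gives
  \<open>\<sigma> * z \<phi> = \<sigma> * z b + divisor c w\<close>; then the root of
  \<open>\<phi>\<close> is split off.\<close>

lemma sym_exchange:
  assumes "unit_step E \<rho>" "unit_step E \<rho>'"
    and "\<And>A. A \<subseteq> E \<Longrightarrow> \<rho> A + m = \<rho>' A + of_bool (\<delta> A)"
    and "\<And>A x. A \<subseteq> E \<Longrightarrow> x \<in> E \<Longrightarrow> \<delta> A \<Longrightarrow> \<delta> (insert x A)"
    and "\<not> \<delta> {}" "\<delta> E" "b \<in> E"
    and c: "\<And>A. A \<subseteq> E \<Longrightarrow> \<sigma> * (of_bool (\<delta> A) - of_bool (b \<in> A)) = of_bool (c A)"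
    and w: "w \<in> permutations_of_set E"
  shows "sym \<sigma> (Suc a) (jumps \<rho> w) = sym \<sigma> (Suc a) (jumps \<rho>' w) +
    \<sigma> * z b * sym \<sigma> a (jumps \<rho>' w) + divisor c w * sym \<sigma> a (jumps \<rho>' w)"
proof -
  note w' = finite_length_permutations_of_set[OF w]
  obtain \<phi> where p: "\<phi> \<in> set w" "jumps \<rho> w = insert \<phi> (jumps \<rho>' w)" "\<phi> \<notin> jumps \<rho>' w"
    and pre: "\<And>k. k \<le> length w \<Longrightarrow> \<delta> (set (take k w)) \<longleftrightarrow> \<phi> \<in> set (take k w)"
    using jumps_exchange[OF assms(1-5), of w] assms(6) w' by blast
  have "divisor c w = (\<Sum>k<length w - 1. \<sigma> *
      (of_bool (\<phi> \<in> set (take (Suc k) w)) * (z (w ! k) - z (w ! Suc k)) -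
       of_bool (b \<in> set (take (Suc k) w)) * (z (w ! k) - z (w ! Suc k))))"
    unfolding divisor_def
  proof (rule sum.cong[OF refl])
    fix k assume "k \<in> {..<length w - 1}"
    then have "Suc k \<le> length w" by auto
    moreover have "set (take (Suc k) w) \<subseteq> E" using w'(1) set_take_subset by fast
    ultimately have c': "of_bool (c (set (take (Suc k) w))) =
        \<sigma> * (of_bool (\<phi> \<in> set (take (Suc k) w)) - of_bool (b \<in> set (take (Suc k) w)))"
      using c[of "set (take (Suc k) w)"] pre[of "Suc k"] by simp
    show "of_bool (c (set (take (Suc k) w))) * (z (w ! k) - z (w ! Suc k)) = \<sigma> *
      (of_bool (\<phi> \<in> set (take (Suc k) w)) * (z (w ! k) - z (w ! Suc k)) -
       of_bool (b \<in> set (take (Suc k) w)) * (z (w ! k) - z (w ! Suc k)))"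
      unfolding c' by (simp add: algebra_simps)
  qed
  also have "\<dots> = \<sigma> * (z \<phi> - z b)"
    unfolding sum_distrib_left[symmetric] sum_subtractf
    using telescope_prefix[OF w'(2) p(1)] telescope_prefix[OF w'(2), of b] assms(7) w'(1)
    by simp
  finally have "\<sigma> * z \<phi> = \<sigma> * z b + divisor c w" by (simp add: algebra_simps)
  moreover have "sym \<sigma> (Suc a) (jumps \<rho> w) =
      sym \<sigma> (Suc a) (jumps \<rho>' w) + \<sigma> * z \<phi> * sym \<sigma> a (jumps \<rho>' w)"
    unfolding p(2) sym_def by (rule esym_Suc_insert) (use p(3) in auto)
  ultimately show ?thesis by (simp add: algebra_simps)
qed

text \<open>
  For a rank function \<open>b\<close> is contracted and turned into a loop, for a nullity function it is deleted
  and turned into a coloop. Either way the Chern root that is lost differs from \<open>\<sigma> * z b\<close> by an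
  effective divisor.
\<close>

lemma sym_step:
  assumes "finite E" "tame E \<sigma> \<rho>" "\<rho> {} < \<rho> E"
  obtains \<rho>' b c where "tame E \<sigma> \<rho>'" "\<rho>' E + \<rho> {} + 1 = \<rho> E + \<rho>' {}"
    "\<forall>w a. w \<in> permutations_of_set E \<longrightarrow>
       sym \<sigma> (Suc a) (jumps \<rho> w) = sym \<sigma> (Suc a) (jumps \<rho>' w) +
         \<sigma> * z b * sym \<sigma> a (jumps \<rho>' w) + divisor c w * sym \<sigma> a (jumps \<rho>' w)"
proof -
  note u = tame_unit_step[OF assms(2)]
  consider "\<sigma> = 1" "\<And>A B. A \<subseteq> E \<Longrightarrow> B \<subseteq> E \<Longrightarrow> \<rho> (A \<union> B) + \<rho> (A \<inter> B) \<le> \<rho> A + \<rho> B"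
    | "\<sigma> = -1" "\<And>A B. A \<subseteq> E \<Longrightarrow> B \<subseteq> E \<Longrightarrow> \<rho> A + \<rho> B \<le> \<rho> (A \<union> B) + \<rho> (A \<inter> B)"
    using assms(2) unfolding tame_def by blast
  then show thesis
  proof cases
    case 1
    \<comment> \<open>Otherwise submodularity, applied one element at a time, would give
      \<open>\<rho> E \<le> \<rho> {}\<close>.\<close>
    have "\<exists>b\<in>E. \<rho> {} < \<rho> {b}"
    proof (rule ccontr)
      assume no: "\<not> ?thesis"
      have "\<rho> A \<le> \<rho> {}" if "A \<subseteq> E" for A
        using finite_subset[OF that assms(1)] that
      proof (induction A rule: finite_induct)
        case (insert x A)
        then have "A \<subseteq> E" "{x} \<subseteq> E" "A \<inter> {x} = {}" "\<rho> {x} \<le> \<rho> {}" using no by auto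
        then show ?case using 1(2)[of A "{x}"] insert by simp
      qed simp
      then show False using assms(3) by fastforce
    qed
    then obtain b where b: "b \<in> E" "\<rho> {} < \<rho> {b}" by blast
    have b1: "\<rho> {b} = Suc (\<rho> {})" using unit_stepD[OF u, of "{}" b] b by auto
    let ?r = "\<lambda>A. \<rho> (insert b A)"
    \<comment> \<open>This says that \<open>b\<close> lies in the closure of \<open>A\<close>. It
      holds whenever \<open>b \<in> A\<close>, so the difference of the two indicators is again an
      indicator and the divisor is effective.\<close>
    let ?d = "\<lambda>A. \<rho> (insert b A) = \<rho> A"
    have t: "tame E \<sigma> ?r" using tame_insert[OF assms(2) b(1)] .
    have m: "\<rho> A + 1 = ?r A + of_bool (?d A)" if "A \<subseteq> E" for A
      using unit_stepD[OF u that b(1)] by auto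
    have mono: "?d (insert x A)" if "A \<subseteq> E" "x \<in> E" "?d A" for A x
    proof (cases "b \<in> insert x A")
      case True
      then show ?thesis by (simp add: insert_absorb)
    next
      case False
      have "insert x A \<union> insert b A = insert b (insert x A)" "insert x A \<inter> insert b A = A"
        using False by auto
      then have "\<rho> (insert b (insert x A)) + \<rho> A \<le> \<rho> (insert x A) + \<rho> (insert b A)"
        using 1(2)[of "insert x A" "insert b A"] that b by simp
      then show ?thesis
        using that unit_stepD(1)[OF u, of "insert x A" b] b by simp
    qed
    have st: "sym \<sigma> (Suc a) (jumps \<rho> w) = sym \<sigma> (Suc a) (jumps ?r w) +
         \<sigma> * z b * sym \<sigma> a (jumps ?r w) +
         divisor (\<lambda>A. ?d A \<and> b \<notin> A) w * sym \<sigma> a (jumps ?r w)"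
      if "w \<in> permutations_of_set E" for w a
    proof (rule sym_exchange[OF u tame_unit_step[OF t] m mono])
      show "\<sigma> * (of_bool (?d A) - of_bool (b \<in> A)) = of_bool (?d A \<and> b \<notin> A)" for A
        using 1(1) by (cases "b \<in> A") (auto simp: insert_absorb)
    qed (use that b b1 in \<open>auto simp: insert_absorb\<close>)
    have "?r E + \<rho> {} + 1 = \<rho> E + ?r {}" using b b1 by (simp add: insert_absorb)
    then show thesis by (rule that[OF t]) (use st in blast)
  next
    case 2
    \<comment> \<open>The dual choice: if no single removal lowered the value, supermodularity would
      allow all elements to be removed without loss.\<close>
    have "\<exists>b\<in>E. \<rho> (E - {b}) < \<rho> E"
    proof (rule ccontr)
      assume no: "\<not> ?thesis"
      have "\<rho> E \<le> \<rho> (E - A)" if "A \<subseteq> E" for A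
        using finite_subset[OF that assms(1)] that
      proof (induction A rule: finite_induct)
        case (insert x A)
        have "(E - A) \<union> (E - {x}) = E" "(E - A) \<inter> (E - {x}) = E - insert x A"
          using insert by auto
        moreover have "\<rho> E \<le> \<rho> (E - {x})" using no insert by auto
        ultimately show ?case using 2(2)[of "E - A" "E - {x}"] insert by auto
      qed simp
      then have "\<rho> E \<le> \<rho> (E - E)" by blast
      then show False using assms(3) by simp
    qed
    then obtain b where b: "b \<in> E" "\<rho> (E - {b}) < \<rho> E" by blast
    have rem: "\<rho> (A - {b}) \<le> \<rho> A" "\<rho> A \<le> Suc (\<rho> (A - {b}))" if "A \<subseteq> E" for A
    proof -
      have "A - {b} \<subseteq> E" using that by auto
      then show "\<rho> (A - {b}) \<le> \<rho> A" "\<rho> A \<le> Suc (\<rho> (A - {b}))"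
        using unit_stepD[OF u, of "A - {b}" b] b by (cases "b \<in> A"; simp add: insert_absorb)+
    qed
    have b1: "\<rho> E = Suc (\<rho> (E - {b}))" using rem[of E] b by auto
    let ?r = "\<lambda>A. \<rho> (A - {b})"
    \<comment> \<open>Now \<open>?d A\<close> forces \<open>b \<in> A\<close>, so the difference of
      the indicators is never positive, and the sign \<open>\<sigma> = -1\<close> makes the divisor
      effective.\<close>
    let ?d = "\<lambda>A. \<rho> (A - {b}) < \<rho> A"
    have t: "tame E \<sigma> ?r" using tame_remove[OF assms(2)] .
    have m: "\<rho> A + 0 = ?r A + of_bool (?d A)" if "A \<subseteq> E" for A
      using rem[OF that] by auto
    have mono: "?d (insert x A)" if "A \<subseteq> E" "x \<in> E" "?d A" for A x
    proof (cases "x \<in> A")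
      case True
      then show ?thesis using that by (simp add: insert_absorb)
    next
      case False
      have bA: "b \<in> A" using that(3) by (cases "b \<in> A") auto
      have "A \<union> (insert x A - {b}) = insert x A" "A \<inter> (insert x A - {b}) = A - {b}"
        using False bA by auto
      then have "\<rho> A + \<rho> (insert x A - {b}) \<le> \<rho> (insert x A) + \<rho> (A - {b})"
        using 2(2)[of A "insert x A - {b}"] that by auto
      then show ?thesis using that by simp
    qed
    have st: "sym \<sigma> (Suc a) (jumps \<rho> w) = sym \<sigma> (Suc a) (jumps ?r w) +
         \<sigma> * z b * sym \<sigma> a (jumps ?r w) +
         divisor (\<lambda>A. b \<in> A \<and> \<not> ?d A) w * sym \<sigma> a (jumps ?r w)"
      if "w \<in> permutations_of_set E" for w a
    proof (rule sym_exchange[OF u tame_unit_step[OF t] m mono])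
      show "\<sigma> * (of_bool (?d A) - of_bool (b \<in> A)) = of_bool (b \<in> A \<and> \<not> ?d A)" for A
        using 2(1) by (cases "b \<in> A") auto
    qed (use that b in auto)
    have "?r E + \<rho> {} + 1 = \<rho> E + ?r {}" using b1 by simp
    then show thesis by (rule that[OF t]) (use st in blast)
  qed
qed

section \<open>Products of Chern classes, graded by total degree, and their restriction to boundary
  divisors\<close>

inductive nef :: "'a set \<Rightarrow> nat \<Rightarrow> ('a list \<Rightarrow> 'k) \<Rightarrow> bool" for E where
  nef_one: "(\<And>w. w \<in> permutations_of_set E \<Longrightarrow> f w = 1) \<Longrightarrow> nef E 0 f"
| nef_mult: "nef E d f \<Longrightarrow> tame E \<sigma> \<rho> \<Longrightarrow>
    (\<And>w. w \<in> permutations_of_set E \<Longrightarrow> g w = f w * sym \<sigma> a (jumps \<rho> w)) \<Longrightarrow> nef E (d + a) g"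

lemma nef_cong:
  assumes "nef E d f" "\<And>w. w \<in> permutations_of_set E \<Longrightarrow> f w = g w"
  shows "nef E d g"
  using assms(1)
proof cases
  case nef_one
  then show ?thesis using assms(2) nef.nef_one[of E g] by simp
next
  case (nef_mult d f' \<sigma> \<rho> a)
  then show ?thesis using assms(2) nef.nef_mult[of E d f' \<sigma> \<rho> g a] by simp
qed

lemma nef_sym: "tame E \<sigma> \<rho> \<Longrightarrow> nef E a (\<lambda>w. sym \<sigma> a (jumps \<rho> w))"
  using nef_mult[OF nef_one[of E "\<lambda>_. 1"], of \<sigma> \<rho> "\<lambda>w. sym \<sigma> a (jumps \<rho> w)" a] by simp

lemma nef_times:
  assumes "nef E d f" "nef E l g"
  shows "nef E (d + l) (\<lambda>w. f w * g w)"
  using assms(2)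
proof induction
  case (nef_one g)
  then show ?case using nef_cong[OF assms(1)] by simp
next
  case (nef_mult l g \<sigma> \<rho> h a)
  have "nef E ((d + l) + a) (\<lambda>w. f w * h w)"
    by (rule nef.nef_mult[OF nef_mult.IH nef_mult.hyps(2)]) (simp add: nef_mult.hyps(3) mult.assoc)
  then show ?case by (simp add: add.assoc)
qed

text \<open>The boundary divisor of \<open>S\<close> is a product of two permutohedral varieties,
  and a nef class restricts there to a sum of tensor products of nef classes. Sums are needed
  because the Whitney formula produces them.\<close>

inductive nef2 :: "'a set \<Rightarrow> 'a set \<Rightarrow> nat \<Rightarrow> ('a list \<Rightarrow> 'a list \<Rightarrow> 'k) \<Rightarrow> bool" for S T where
  tensor: "nef S d p \<Longrightarrow> nef T l q \<Longrightarrow>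
    (\<And>u v. u \<in> permutations_of_set S \<Longrightarrow> v \<in> permutations_of_set T \<Longrightarrow> F u v = p u * q v) \<Longrightarrow>
    nef2 S T (d + l) F"
| zero: "(\<And>u v. u \<in> permutations_of_set S \<Longrightarrow> v \<in> permutations_of_set T \<Longrightarrow> F u v = 0) \<Longrightarrow>
    nef2 S T d F"
| add: "nef2 S T d F \<Longrightarrow> nef2 S T d G \<Longrightarrow>
    (\<And>u v. u \<in> permutations_of_set S \<Longrightarrow> v \<in> permutations_of_set T \<Longrightarrow> H u v = F u v + G u v) \<Longrightarrow>
    nef2 S T d H"

lemma nef2_cong:
  assumes "nef2 S T d F"
    and "\<And>u v. u \<in> permutations_of_set S \<Longrightarrow> v \<in> permutations_of_set T \<Longrightarrow> G u v = F u v"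
  shows "nef2 S T d G"
  by (rule nef2.add[OF assms(1) nef2.zero[of S T "\<lambda>_ _. 0"]]) (simp_all add: assms(2))

lemma nef2_sum:
  assumes "finite I" "\<And>i. i \<in> I \<Longrightarrow> nef2 S T d (F i)"
  shows "nef2 S T d (\<lambda>u v. \<Sum>i\<in>I. F i u v)"
  using assms
proof (induction I rule: finite_induct)
  case empty
  then show ?case by (auto intro: nef2.zero)
next
  case (insert i I)
  then have "nef2 S T d (F i)" "nef2 S T d (\<lambda>u v. \<Sum>i\<in>I. F i u v)" by simp_all
  then show ?case by (rule nef2.add) (simp add: insert.hyps)
qed

text \<open>The Whitney sum formula on the boundary divisor: the roots fall apart into those of the
  restriction to \<open>set u\<close> and those of the contraction by it.\<close>

lemma sym_append:
  assumes "set u \<inter> set v = {}"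
  shows "sym \<sigma> a (jumps \<rho> (u @ v)) =
    (\<Sum>i\<le>a. sym \<sigma> i (jumps \<rho> u) * sym \<sigma> (a - i) (jumps (\<lambda>A. \<rho> (set u \<union> A)) v))"
proof -
  have "jumps \<rho> u \<inter> jumps (\<lambda>A. \<rho> (set u \<union> A)) v = {}"
    using assms jumps_subset[of \<rho> u] jumps_subset[of "\<lambda>A. \<rho> (set u \<union> A)" v] by blast
  then show ?thesis unfolding jumps_append sym_def by (intro esym_Un) auto
qed

text \<open>By \<open>sym_append\<close> a single tensor becomes a sum of tensors; in each of them
  both factors gain one Chern class, and the degrees \<open>i\<close> and \<open>a - i\<close> add
  up to \<open>a\<close>.\<close>

lemma nef2_mult:
  assumes "nef2 S T d F" "tame E \<sigma> \<rho>" "S \<subseteq> E" "T \<subseteq> E" "S \<inter> T = {}"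
  shows "nef2 S T (d + a) (\<lambda>u v. F u v * sym \<sigma> a (jumps \<rho> (u @ v)))"
  using assms(1)
proof induction
  case (tensor d p l q F)
  have "nef2 S T (d + l + a) (\<lambda>u v. \<Sum>i\<le>a. (p u * sym \<sigma> i (jumps \<rho> u)) *
      (q v * sym \<sigma> (a - i) (jumps (\<lambda>A. \<rho> (S \<union> A)) v)))"
  proof (intro nef2_sum)
    fix i assume "i \<in> {..a}"
    then have deg: "(d + i) + (l + (a - i)) = d + l + a" by simp
    have "nef2 S T ((d + i) + (l + (a - i))) (\<lambda>u v. (p u * sym \<sigma> i (jumps \<rho> u)) *
      (q v * sym \<sigma> (a - i) (jumps (\<lambda>A. \<rho> (S \<union> A)) v)))"
      by (rule nef2.tensor[OF nef_times[OF tensor(1) nef_sym[OF tame_subset[OF assms(2,3)]]]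
            nef_times[OF tensor(2) nef_sym[OF tame_shift[OF assms(2-4)]]] refl])
    then show "nef2 S T (d + l + a) (\<lambda>u v. (p u * sym \<sigma> i (jumps \<rho> u)) *
      (q v * sym \<sigma> (a - i) (jumps (\<lambda>A. \<rho> (S \<union> A)) v)))"
      unfolding deg .
  qed simp
  then show ?case
  proof (rule nef2_cong)
    fix u v assume uv: "u \<in> permutations_of_set S" "v \<in> permutations_of_set T"
    note u = finite_length_permutations_of_set[OF uv(1)]
    note v = finite_length_permutations_of_set[OF uv(2)]
    show "F u v * sym \<sigma> a (jumps \<rho> (u @ v)) = (\<Sum>i\<le>a. (p u * sym \<sigma> i (jumps \<rho> u)) *
      (q v * sym \<sigma> (a - i) (jumps (\<lambda>A. \<rho> (S \<union> A)) v)))"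
      using sym_append[of u v \<sigma> a \<rho>] u v assms(5) tensor(3)[OF uv]
      by (simp add: sum_distrib_left mult_ac)
  qed
next
  case (zero F d)
  then show ?case by (intro nef2.zero) simp
next
  case (add d F G H)
  show ?case
    by (rule nef2.add[OF add.IH]) (simp add: add.hyps(3) algebra_simps)
qed

lemma nef_split:
  assumes "nef E d f" "S \<subseteq> E"
  shows "nef2 S (E - S) d (\<lambda>u v. f (u @ v))"
  using assms(1)
proof induction
  case (nef_one f)
  have p: "u @ v \<in> permutations_of_set E"
    if "u \<in> permutations_of_set S" "v \<in> permutations_of_set (E - S)" for u v
    using that assms(2) by (auto simp: permutations_of_set_def)
  have "nef2 S (E - S) (0 + 0) (\<lambda>u v. f (u @ v))"
    by (rule nef2.tensor[of S 0 "\<lambda>_. 1" "E - S" 0 "\<lambda>_. 1"])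
       (auto intro: nef.nef_one simp: nef_one[OF p])
  then show ?case by simp
next
  case (nef_mult d f \<sigma> \<rho> g a)
  have p: "u @ v \<in> permutations_of_set E"
    if "u \<in> permutations_of_set S" "v \<in> permutations_of_set (E - S)" for u v
    using that assms(2) by (auto simp: permutations_of_set_def)
  show ?case
    by (rule nef2_cong[OF nef2_mult[OF nef_mult.IH nef_mult.hyps(2) assms(2)]])
       (auto simp: nef_mult.hyps(3)[OF p])
qed

text \<open>Joins vanishing below the dimension \<open>m\<close> to nonnegativity in dimension
  \<open>m\<close>, so that one induction yields both. Nothing is asked above \<open>m\<close>,
  where a localization sum need not be constant.\<close>

definition graded :: "nat \<Rightarrow> nat \<Rightarrow> 'k \<Rightarrow> bool" where
  "graded d m x \<longleftrightarrow> (d < m \<longrightarrow> x = 0) \<and> (d = m \<longrightarrow> x \<in> \<nat>)"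

lemma graded_0 [simp]: "graded d m 0"
  by (simp add: graded_def)

lemma graded_add: "graded d m x \<Longrightarrow> graded d m y \<Longrightarrow> graded d m (x + y)"
  by (simp add: graded_def)

lemma graded_sum: "(\<And>i. i \<in> I \<Longrightarrow> graded d m (x i)) \<Longrightarrow> graded d m (\<Sum>i\<in>I. x i)"
  by (induction I rule: infinite_finite_induct) (auto intro: graded_add)

text \<open>If the total degree is at most \<open>m + n\<close>, then either one factor lies below
  its dimension and vanishes, or both are in their top degree.\<close>

lemma graded_mult: "graded d m x \<Longrightarrow> graded l n y \<Longrightarrow> graded (d + l) (m + n) (x * y)"
  unfolding graded_def by (cases "d < m"; cases "l < n") auto

text \<open>This disposes of the constant \<open>\<sigma> * z b\<close> in the recursion: the scalar
  \<open>c\<close> is arbitrary, yet wherever the conclusion imposes a condition, \<open>x\<close>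
  is already 0.\<close>

lemma graded_cmult: "graded d m x \<Longrightarrow> graded (Suc d) m (c * x)"
  by (cases "d < m") (auto simp: graded_def)

lemma graded_shift:
  assumes "graded d m x" "d + n = l + m"
  shows "graded l n x"
proof -
  have "l < n \<longleftrightarrow> d < m" "l = n \<longleftrightarrow> d = m" using assms(2) by auto
  then show ?thesis using assms(1) by (simp add: graded_def)
qed

text \<open>
  The induction common to the positivity of all top degree products of nef tautological classes
  (\<open>\<kappa> = 1\<close>) and to that of the coefficients of the \<open>g\<close>-polynomial.
\<close>

lemma graded_degree_sum_times:
  assumes E: "finite E"
    and one: "graded 0 m (degree_sum E \<kappa>)"
    and split: "\<And>S d p l q. S \<subset> E \<Longrightarrow> S \<noteq> {} \<Longrightarrow> nef S d p \<Longrightarrow> nef (E - S) l q \<Longrightarrow>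
      graded (Suc (d + l)) m (degree_sum2 S (E - S) (\<lambda>u v. \<kappa> (u @ v) * (p u * q v)))"
    and "nef E d f"
  shows "graded d m (degree_sum E (\<lambda>w. \<kappa> w * f w))"
  using assms(4)
proof induction
  case (nef_one f)
  have "degree_sum E (\<lambda>w. \<kappa> w * f w) = degree_sum E \<kappa>"
    by (rule degree_sum_cong) (simp add: nef_one)
  then show ?case using one by simp
next
  case (nef_mult d f \<sigma> \<rho> g a)
  \<comment> \<open>Additivity extends the assumption from single tensors to all restrictions of nef
    classes.\<close>
  have split2: "graded (Suc d) m (degree_sum2 S (E - S) (\<lambda>u v. \<kappa> (u @ v) * F u v))"
    if "nef2 S (E - S) d F" "S \<subset> E" "S \<noteq> {}" for S d F
    using that(1)
  proof induction
    case (tensor d p l q F)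
    have "degree_sum2 S (E - S) (\<lambda>u v. \<kappa> (u @ v) * F u v) =
        degree_sum2 S (E - S) (\<lambda>u v. \<kappa> (u @ v) * (p u * q v))"
      by (rule degree_sum2_cong) (simp add: tensor(3))
    then show ?case using split[OF that(2,3) tensor(1,2)] by simp
  next
    case (zero F d)
    have "degree_sum2 S (E - S) (\<lambda>u v. \<kappa> (u @ v) * F u v) = 0"
      using zero by (simp add: degree_sum2_def)
    then show ?case by simp
  next
    case (add d F G H)
    have "degree_sum2 S (E - S) (\<lambda>u v. \<kappa> (u @ v) * H u v) =
        degree_sum2 S (E - S) (\<lambda>u v. \<kappa> (u @ v) * F u v + \<kappa> (u @ v) * G u v)"
      by (rule degree_sum2_cong) (simp add: add.hyps(3) algebra_simps)
    then show ?case using add.IH by (simp add: degree_sum2_add graded_add)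
  qed
  have "graded (d + a) m (degree_sum E (\<lambda>w. \<kappa> w * (f w * sym \<sigma> a (jumps \<rho> w))))"
    using nef_mult.hyps(2)
  \<comment> \<open>The measure is the number of Chern roots; \<open>a\<close> is generalised
    because each step needs the claim for \<open>a\<close> and for its predecessor.\<close>
  proof (induction "\<rho> E - \<rho> {}" arbitrary: \<rho> a rule: less_induct)
    case (less \<rho> a)
    show ?case
    proof (cases a)
      case 0
      then show ?thesis using nef_mult.IH by (simp add: sym_def)
    next
      case (Suc a')
      show ?thesis
      proof (cases "\<rho> {} < \<rho> E")
        case False
        have "sym \<sigma> a (jumps \<rho> w) = 0" if "w \<in> permutations_of_set E" for w
        proof -
          note w = finite_length_permutations_of_set[OF that]
          have "\<rho> {} + card (jumps \<rho> w) = \<rho> E"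
            using card_jumps[OF tame_unit_step[OF less.prems] w(2)] w(1) by simp
          then have "card (jumps \<rho> w) = 0" using False by linarith
          then show ?thesis unfolding sym_def Suc by (intro esym_gt_card) auto
        qed
        then have "degree_sum E (\<lambda>w. \<kappa> w * (f w * sym \<sigma> a (jumps \<rho> w))) = 0"
          by (simp add: degree_sum_def)
        then show ?thesis by simp
      next
        case True
        obtain \<rho>' b c where t: "tame E \<sigma> \<rho>'" and r: "\<rho>' E + \<rho> {} + 1 = \<rho> E + \<rho>' {}" and
          step: "\<forall>w a. w \<in> permutations_of_set E \<longrightarrow>
             sym \<sigma> (Suc a) (jumps \<rho> w) = sym \<sigma> (Suc a) (jumps \<rho>' w) +
               \<sigma> * z b * sym \<sigma> a (jumps \<rho>' w) + divisor c w * sym \<sigma> a (jumps \<rho>' w)"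
          by (rule sym_step[OF E less.prems True])
        have lt: "\<rho>' E - \<rho>' {} < \<rho> E - \<rho> {}" using r True by linarith
        let ?F = "\<lambda>a w. \<kappa> w * (f w * sym \<sigma> a (jumps \<rho>' w))"
        have "degree_sum E (\<lambda>w. \<kappa> w * (f w * sym \<sigma> a (jumps \<rho> w))) =
            degree_sum E (\<lambda>w. ?F a w + (\<sigma> * z b * ?F a' w + divisor c w * ?F a' w))"
          by (rule degree_sum_cong) (simp add: Suc step algebra_simps)
        also have "\<dots> = degree_sum E (?F a) + (\<sigma> * z b * degree_sum E (?F a') +
            (\<Sum>S | S \<subset> E \<and> S \<noteq> {} \<and> c S. degree_sum2 S (E - S) (\<lambda>u v. ?F a' (u @ v))))"
          by (simp only: degree_sum_add degree_sum_cmult degree_sum_divisor'[OF E])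
        finally have eq: "degree_sum E (\<lambda>w. \<kappa> w * (f w * sym \<sigma> a (jumps \<rho> w))) =
            degree_sum E (?F a) + (\<sigma> * z b * degree_sum E (?F a') +
            (\<Sum>S | S \<subset> E \<and> S \<noteq> {} \<and> c S. degree_sum2 S (E - S) (\<lambda>u v. ?F a' (u @ v))))" .
        have nef': "nef E (d + a') (\<lambda>w. f w * sym \<sigma> a' (jumps \<rho>' w))"
          by (rule nef_times[OF nef_mult.hyps(1) nef_sym[OF t]])
        have "graded (d + a) m (degree_sum E (?F a))"
          using less.hyps[OF lt t] .
        \<comment> \<open>This integrand has degree one less than \<open>d + a\<close>, hence below
          \<open>m\<close> wherever something is to be shown.\<close>
        moreover have "graded (d + a) m (\<sigma> * z b * degree_sum E (?F a'))"
          using graded_cmult[OF less.hyps[OF lt t, of a']] Suc by simp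
        moreover have "graded (d + a) m
            (\<Sum>S | S \<subset> E \<and> S \<noteq> {} \<and> c S. degree_sum2 S (E - S) (\<lambda>u v. ?F a' (u @ v)))"
        proof (rule graded_sum)
          fix S assume "S \<in> {S. S \<subset> E \<and> S \<noteq> {} \<and> c S}"
          then have S: "S \<subset> E" "S \<noteq> {}" by auto
          \<comment> \<open>The divisor has taken over one degree of the integrand, so the rest has
            degree \<open>d + a'\<close> with \<open>a = Suc a'\<close>.\<close>
          show "graded (d + a) m (degree_sum2 S (E - S) (\<lambda>u v. ?F a' (u @ v)))"
            using split2[OF nef_split[OF nef'] S] S Suc by auto
        qed
        ultimately show ?thesis unfolding eq by (intro graded_add)
      qed
    qed
  qed
  moreover have "degree_sum E (\<lambda>w. \<kappa> w * g w) =
      degree_sum E (\<lambda>w. \<kappa> w * (f w * sym \<sigma> a (jumps \<rho> w)))"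
    by (rule degree_sum_cong) (simp add: nef_mult.hyps(3))
  ultimately show ?case by simp
qed

text \<open>Induction on the ground set: the two sides of a boundary divisor have dimensions
  \<open>card S - 1\<close> and \<open>card (E - S) - 1\<close>, which sum to one less than
  \<open>card E - 1\<close>. The recursion ends with the degree of 1.\<close>

theorem graded_degree_sum_nef:
  assumes "finite E" "E \<noteq> {}" "nef E d f"
  shows "graded d (card E - 1) (degree_sum E f)"
  using assms
proof (induction "card E" arbitrary: E d f rule: less_induct)
  case less
  have "graded d (card E - 1) (degree_sum E (\<lambda>w. 1 * f w))"
  proof (rule graded_degree_sum_times[OF less.prems(1) _ _ less.prems(3)])
    show "graded 0 (card E - 1) (degree_sum E (\<lambda>_. 1))"
    proof (cases "card E = 1")
      case True
      then obtain t where "E = {t}" using card_1_singletonE by blast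
      then show ?thesis by (simp add: graded_def degree_sum_def den_def)
    next
      case False
      then have "2 \<le> card E" using less.prems by (cases "card E") auto
      then show ?thesis using degree_sum_one[OF less.prems(1)] by simp
    qed
  next
    fix S d l p q assume S: "S \<subset> E" "S \<noteq> {}" and pq: "nef S d p" "nef (E - S) l q"
    have fin: "finite S" "finite (E - S)" using S less.prems finite_subset by auto
    have lt: "card S < card E" "card (E - S) < card E"
      using S less.prems by (auto intro!: psubset_card_mono)
    have ne: "E - S \<noteq> {}" using S by auto
    have "graded (d + l) ((card S - 1) + (card (E - S) - 1)) (degree_sum S p * degree_sum (E - S) q)"
      by (intro graded_mult less.hyps lt fin S ne pq)
    moreover have "card E = card S + card (E - S)"
      using card_Un_disjoint[OF fin] S by (simp add: Un_absorb1 psubset_imp_subset)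
    moreover have "card S \<noteq> 0" "card (E - S) \<noteq> 0"
      using S fin ne by auto
    ultimately have "graded (Suc (d + l)) (card E - 1) (degree_sum S p * degree_sum (E - S) q)"
      by (elim graded_shift) simp
    then show "graded (Suc (d + l)) (card E - 1) (degree_sum2 S (E - S) (\<lambda>u v. 1 * (p u * q v)))"
      by (simp add: degree_sum2_tensor)
  qed
  then show ?case by simp
qed

end

section \<open>Rank, nullity and contraction\<close>

lemma matroid_finite: "matroid M \<Longrightarrow> finite (ground M)"
  by (simp add: matroid_def)

lemma rk_le_card: "matroid M \<Longrightarrow> A \<subseteq> ground M \<Longrightarrow> rk M A \<le> card A"
  by (simp add: matroid_def)

lemma rk_mono: "matroid M \<Longrightarrow> A \<subseteq> B \<Longrightarrow> B \<subseteq> ground M \<Longrightarrow> rk M A \<le> rk M B"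
  unfolding matroid_def by blast

lemma rk_submodular:
  "matroid M \<Longrightarrow> A \<subseteq> ground M \<Longrightarrow> B \<subseteq> ground M \<Longrightarrow>
     rk M (A \<union> B) + rk M (A \<inter> B) \<le> rk M A + rk M B"
  unfolding matroid_def by blast

lemma rk_empty: "matroid M \<Longrightarrow> rk M {} = 0"
  using rk_le_card[of M "{}"] by simp

lemma rk_insert_le:
  assumes "matroid M" "A \<subseteq> ground M" "x \<in> ground M"
  shows "rk M (insert x A) \<le> rk M A + rk M {x}"
  using rk_submodular[OF assms(1,2), of "{x}"] assms(3) by simp

lemma tame_rk:
  assumes "matroid M"
  shows "tame (ground M) (1 :: 'k::ring_1) (rk M)"
proof -
  have "rk M A \<le> rk M (insert x A) \<and> rk M (insert x A) \<le> Suc (rk M A)"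
    if "A \<subseteq> ground M" "x \<in> ground M" for A x
    using rk_mono[OF assms, of A "insert x A"] rk_insert_le[OF assms that]
      rk_le_card[OF assms, of "{x}"] that by auto
  then show ?thesis using rk_submodular[OF assms] by (simp add: tame_def unit_step_def)
qed

definition nullity :: "'a ranked_set \<Rightarrow> 'a set \<Rightarrow> nat" where
  "nullity M A = card A - rk M A"

lemma nullity_add_rk: "matroid M \<Longrightarrow> A \<subseteq> ground M \<Longrightarrow> nullity M A + rk M A = card A"
  by (simp add: nullity_def rk_le_card)

lemma nullity_empty: "nullity M {} = 0"
  by (simp add: nullity_def)

text \<open>Cardinality is modular, so subtracting the submodular rank leaves a supermodular
  function.\<close>

lemma tame_nullity:
  assumes M: "matroid M"
  shows "tame (ground M) (-1 :: 'k::ring_1) (nullity M)"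
proof -
  have fin: "finite A" if "A \<subseteq> ground M" for A
    using that matroid_finite[OF M] finite_subset by blast
  have "nullity M A \<le> nullity M (insert x A) \<and> nullity M (insert x A) \<le> Suc (nullity M A)"
    if "A \<subseteq> ground M" "x \<in> ground M" for A x
  proof (cases "x \<in> A")
    case True
    then show ?thesis by (simp add: insert_absorb)
  next
    case False
    have ins: "insert x A \<subseteq> ground M" using that by simp
    have "card (insert x A) = Suc (card A)" using False fin[OF that(1)] by simp
    then show ?thesis
      using nullity_add_rk[OF M that(1)] nullity_add_rk[OF M ins]
        unit_stepD[OF tame_unit_step[OF tame_rk[where 'k = int, OF M]] that]
      by linarith
  qed
  moreover have "nullity M A + nullity M B \<le> nullity M (A \<union> B) + nullity M (A \<inter> B)"
    if "A \<subseteq> ground M" "B \<subseteq> ground M" for A B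
  proof -
    have "A \<union> B \<subseteq> ground M" "A \<inter> B \<subseteq> ground M" using that by auto
    then show ?thesis
      using nullity_add_rk[OF M that(1)] nullity_add_rk[OF M that(2)]
        nullity_add_rk[OF M, of "A \<union> B"] nullity_add_rk[OF M, of "A \<inter> B"]
        card_Un_Int[OF fin[OF that(1)] fin[OF that(2)]] rk_submodular[OF M that]
      by linarith
  qed
  ultimately show ?thesis by (simp add: tame_def unit_step_def)
qed

section \<open>Contractions: rank, flats and nullity\<close>

lemma ground_contract [simp]: "ground (contract M S) = ground M - S"
  by (simp add: contract_def)

lemma rk_contract: "rk (contract M S) A = rk M (A \<union> S) - rk M S"
  by (simp add: contract_def)

lemma matroid_contract:
  assumes M: "matroid M" and S: "S \<subseteq> ground M"
  shows "matroid (contract M S)"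
proof -
  have sub: "A \<union> S \<subseteq> ground M" if "A \<subseteq> ground M - S" for A using that S by auto
  have ge: "rk M S \<le> rk M (A \<union> S)" if "A \<subseteq> ground M - S" for A
    using rk_mono[OF M _ sub[OF that]] by simp
  have card: "rk M (A \<union> S) - rk M S \<le> card A" if "A \<subseteq> ground M - S" for A
  proof -
    have A: "A \<subseteq> ground M" using that by auto
    show ?thesis using rk_submodular[OF M A S] rk_le_card[OF M A] by linarith
  qed
  have mono: "rk M (A \<union> S) - rk M S \<le> rk M (B \<union> S) - rk M S"
    if "A \<subseteq> B" "B \<subseteq> ground M - S" for A B
  proof -
    have "A \<union> S \<subseteq> B \<union> S" using that by auto
    then show ?thesis using rk_mono[OF M _ sub[OF that(2)]] by (intro diff_le_mono) auto
  qed
  have submod: "(rk M (A \<union> B \<union> S) - rk M S) + (rk M (A \<inter> B \<union> S) - rk M S) \<le>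
      (rk M (A \<union> S) - rk M S) + (rk M (B \<union> S) - rk M S)"
    if "A \<subseteq> ground M - S" "B \<subseteq> ground M - S" for A B
  proof -
    have u: "A \<union> B \<subseteq> ground M - S" "A \<inter> B \<subseteq> ground M - S" using that by auto
    have "(A \<union> S) \<union> (B \<union> S) = A \<union> B \<union> S" "(A \<union> S) \<inter> (B \<union> S) = A \<inter> B \<union> S" by auto
    then show ?thesis
      using rk_submodular[OF M sub[OF that(1)] sub[OF that(2)]]
        ge[OF that(1)] ge[OF that(2)] ge[OF u(1)] ge[OF u(2)]
      by simp
  qed
  show ?thesis
    unfolding matroid_def ground_contract rk_contract
    using matroid_finite[OF M] card mono submod by blast
qed

lemma mrank_contract:
  assumes "matroid M" "S \<subseteq> ground M"
  shows "mrank (contract M S) + rk M S = mrank M"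
proof -
  have "ground M - S \<union> S = ground M" using assms(2) by auto
  then show ?thesis using rk_mono[OF assms(1,2)] by (simp add: mrank_def rk_contract)
qed

lemma contract_empty:
  assumes "matroid M"
  shows "contract M {} = M"
  using rk_empty[OF assms] by (simp add: contract_def)

lemma contract_contract:
  assumes M: "matroid M" and S: "S \<subseteq> ground M" and F: "F \<subseteq> ground M - S"
  shows "contract (contract M S) F = contract M (S \<union> F)"
proof -
  have "F \<union> S \<subseteq> ground M" using S F by auto
  then have "rk M S \<le> rk M (F \<union> S)" using rk_mono[OF M] by simp
  then have "rk M (A \<union> F \<union> S) - rk M S - (rk M (F \<union> S) - rk M S) =
      rk M (A \<union> (S \<union> F)) - rk M (S \<union> F)" for A
    by (simp add: Un_ac)
  then show ?thesis by (simp add: contract_def Diff_eq Int_assoc)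
qed

text \<open>Passes an assumption about all proper flats of \<open>M\<close> on to
  \<open>contract M S\<close>, where \<open>S\<close> itself need not be a flat.\<close>

lemma flat_contract:
  assumes M: "matroid M" and S: "S \<subseteq> ground M" and F: "flat (contract M S) F"
  shows "flat M (S \<union> F)"
  unfolding flat_def
proof (intro conjI ballI)
  show "S \<union> F \<subseteq> ground M" using S F by (auto simp: flat_def)
  fix e assume "e \<in> ground M - (S \<union> F)"
  then have "rk (contract M S) F < rk (contract M S) (insert e F)"
    using F by (auto simp: flat_def)
  then have "rk M (F \<union> S) < rk M (insert e F \<union> S)" by (simp add: rk_contract)
  then show "rk M (S \<union> F) < rk M (insert e (S \<union> F))" by (simp add: Un_commute)
qed

lemma nullity_contract:
  assumes M: "matroid M" and S: "S \<subseteq> ground M" and A: "A \<subseteq> ground M - S"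
  shows "nullity M (S \<union> A) = nullity M S + nullity (contract M S) A"
proof -
  have sub: "S \<union> A \<subseteq> ground M" using S A by auto
  have fin: "finite S" "finite A" using sub matroid_finite[OF M] finite_subset by auto
  have "card (S \<union> A) = card S + card A" using A fin by (intro card_Un_disjoint) auto
  moreover have "rk (contract M S) A + rk M S = rk M (S \<union> A)"
    using rk_mono[OF M _ sub, of S] by (simp add: rk_contract Un_commute)
  moreover have "A \<subseteq> ground (contract M S)" using A by simp
  ultimately show ?thesis
    using nullity_add_rk[OF M S] nullity_add_rk[OF M sub]
      nullity_add_rk[OF matroid_contract[OF M S]]
    by (smt (verit) add.assoc add.commute add_left_cancel)
qed

lemma jumps_nullity_contract:
  assumes M: "matroid M" and S: "S \<subseteq> ground M" and v: "set v \<subseteq> ground M - S"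
  shows "jumps (\<lambda>A. nullity M (S \<union> A)) v = jumps (nullity (contract M S)) v"
proof (rule jumps_cong[OF v])
  fix A x assume "A \<subseteq> ground M - S" "x \<in> ground M - S"
  then show "nullity M (S \<union> A) < nullity M (S \<union> insert x A) \<longleftrightarrow>
      nullity (contract M S) A < nullity (contract M S) (insert x A)"
    using nullity_contract[OF M S, of A] nullity_contract[OF M S, of "insert x A"] by simp
qed

text \<open>For nonempty \<open>E\<close> this is the nullity of the uniform matroid of corank one.
  Its only jump is at the last element, which makes \<open>alpha\<close> the first Chern class of a
  quotient bundle and thus nef.\<close>

lemma tame_last:
  "tame E (-1 :: 'k::ring_1) (\<lambda>A. of_bool (A = E))"
  by (auto simp: tame_def unit_step_def)

lemma jumps_last:
  assumes "w \<in> permutations_of_set E" "E \<noteq> {}"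
  shows "jumps (\<lambda>A. of_bool (A = E)) w = {last w}"
proof -
  note w = finite_length_permutations_of_set[OF assms(1)]
  obtain u x where u: "w = u @ [x]" using w(1) assms(2) by (cases w rule: rev_cases) auto
  have x: "x \<notin> set u" "insert x (set u) = E" using u w by auto
  have ne: "A \<noteq> E" if "A \<subseteq> set u" for A using that x by auto
  have "jumps (\<lambda>A. of_bool (A = E)) u = jumps (\<lambda>A. 0) u"
  proof (rule jumps_cong[OF order_refl])
    fix A y assume "A \<subseteq> set u" "y \<in> set u"
    then show "of_bool (A = E) < (of_bool (insert y A = E) :: nat) \<longleftrightarrow> (0::nat) < 0"
      using ne[of A] ne[of "insert y A"] by simp
  qed
  also have "\<dots> = {}" by (simp add: jumps_def)
  finally show ?thesis using x by (auto simp: u jumps_snoc)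
qed

lemma sum_triangle_swap:
  fixes F :: "nat \<Rightarrow> nat \<Rightarrow> 'b::comm_monoid_add"
  shows "(\<Sum>j\<le>k. \<Sum>i\<le>k - j. F j i) = (\<Sum>i\<le>k. \<Sum>j\<le>k - i. F j i)"
proof -
  have "(\<Sum>(j, i)\<in>(SIGMA j:{..k}. {..k - j}). F j i) = (\<Sum>(i, j)\<in>(SIGMA i:{..k}. {..k - i}). F j i)"
    by (rule sum.reindex_bij_witness[of _ "\<lambda>(i, j). (j, i)" "\<lambda>(j, i). (i, j)"]) auto
  then show ?thesis by (simp add: sum.Sigma)
qed

lemma esym_scale: "esym (\<lambda>e. c * g e) k X = c ^ k * esym g k X"
proof (induction X arbitrary: k rule: infinite_finite_induct)
  case (insert x X)
  then show ?case by (cases k) (simp_all add: esym_Suc_insert algebra_simps)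
qed (auto simp: esym_def)


section \<open>The integrands of the coefficients\<close>

context weights
begin

text \<open>The factor \<open>e_{n-r}(y)\<close>, the top Chern class of the tautological quotient
  bundle.\<close>

definition top_class :: "'a ranked_set \<Rightarrow> 'a list \<Rightarrow> 'k" where
  "top_class M w = (\<Prod>e\<in>jumps (nullity M) w. - z e)"

text \<open>For \<open>k = i - 1\<close> this is, up to the sign \<open>(-1)^k\<close>, everything
  in the coefficient of \<open>t^i\<close> except the factor \<open>e_{r-i}(x)\<close>:
  \<open>z (last w)\<close> is minus \<open>alpha\<close>, and the sign of \<open>alpha^j\<close>
  combines with that of \<open>e_{k-j}(-y)\<close>.\<close>

definition kappa :: "'a ranked_set \<Rightarrow> nat \<Rightarrow> 'a list \<Rightarrow> 'k" where
  "kappa M k w = (\<Sum>j\<le>k. z (last w) ^ j * sym (-1) (k - j) (jumps (nullity M) w)) * top_class M w"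

lemma top_class_eq:
  assumes M: "matroid M" and S: "S \<subseteq> ground M" and u: "u \<in> permutations_of_set S"
  shows "top_class M u = sym (-1) (nullity M S) (jumps (nullity M) u)"
proof -
  note u' = finite_length_permutations_of_set[OF u]
  have "nullity M {} + card (jumps (nullity M) u) = nullity M (set u)"
    using card_jumps[OF tame_unit_step[OF tame_nullity[where 'k = int, OF M]] u'(2)] S u'(1) by simp
  then have "nullity M S = card (jumps (nullity M) u)" using u'(1) nullity_empty[of M] by simp
  then show ?thesis by (simp add: top_class_def sym_def esym_card)
qed

lemma nef_top_class:
  assumes M: "matroid M" and S: "S \<subseteq> ground M"
  shows "nef S (nullity M S) (top_class M)"
  by (rule nef_cong[OF nef_sym[OF tame_subset[OF tame_nullity[OF M] S]]])
     (simp add: top_class_eq[OF M S])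

lemma nef_last:
  assumes "E \<noteq> {}"
  shows "nef E j (\<lambda>w. (- z (last w)) ^ j)"
proof (induction j)
  case 0
  show ?case by (rule nef_one) simp
next
  case (Suc j)
  have "sym (-1) 1 (jumps (\<lambda>A. of_bool (A = E)) w) = - z (last w)" if "w \<in> permutations_of_set E" for w
    unfolding jumps_last[OF that assms] sym_def
    using esym_Suc_insert[of "{}" "last w" "\<lambda>e. - 1 * z e" 0] by (simp add: esym_empty)
  then have "nef E (j + 1) (\<lambda>w. (- z (last w)) ^ Suc j)"
    by (intro nef_mult[OF Suc.IH tame_last]) (simp add: mult.commute)
  then show ?case by simp
qed

text \<open>The last element lies in \<open>v\<close>, so the powers of \<open>alpha\<close> belong
  entirely to the contraction. The top class is multiplicative, the other Chern classes split by the
  Whitney formula, and the triangular double sum is reordered.\<close>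

lemma kappa_append:
  assumes M: "matroid M" and S: "S \<subset> ground M"
    and u: "u \<in> permutations_of_set S" and v: "v \<in> permutations_of_set (ground M - S)"
  shows "kappa M k (u @ v) =
    (\<Sum>i\<le>k. sym (-1) i (jumps (nullity M) u) * top_class M u * kappa (contract M S) (k - i) v)"
proof -
  note u' = finite_length_permutations_of_set[OF u]
  note v' = finite_length_permutations_of_set[OF v]
  let ?J = "jumps (nullity M) u" and ?K = "jumps (nullity (contract M S)) v"
  have J: "jumps (\<lambda>A. nullity M (set u \<union> A)) v = ?K"
    using jumps_nullity_contract[OF M, of S v] S u' v' by auto
  have disj: "set u \<inter> set v = {}" using u' v' by auto
  have "?J \<inter> ?K = {}"
    using disj jumps_subset[of "nullity M" u] jumps_subset[of "nullity (contract M S)" v] by blast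
  then have top: "top_class M (u @ v) = top_class M u * top_class (contract M S) v"
    unfolding top_class_def jumps_append J by (intro prod.union_disjoint) auto
  have "v \<noteq> []" using v'(1) S by auto
  then have last: "last (u @ v) = last v" by simp
  have "(\<Sum>j\<le>k. z (last v) ^ j * sym (-1) (k - j) (jumps (nullity M) (u @ v))) =
      (\<Sum>j\<le>k. \<Sum>i\<le>k - j. z (last v) ^ j * (sym (-1) i ?J * sym (-1) (k - j - i) ?K))"
    by (simp add: sym_append[OF disj] J sum_distrib_left)
  also have "\<dots> = (\<Sum>i\<le>k. \<Sum>j\<le>k - i. z (last v) ^ j * (sym (-1) i ?J * sym (-1) (k - j - i) ?K))"
    by (rule sum_triangle_swap)
  also have "\<dots> = (\<Sum>i\<le>k. sym (-1) i ?J * (\<Sum>j\<le>k - i. z (last v) ^ j * sym (-1) (k - i - j) ?K))"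
    by (simp add: sum_distrib_left mult_ac add.commute)
  finally have eq: "(\<Sum>j\<le>k. z (last v) ^ j * sym (-1) (k - j) (jumps (nullity M) (u @ v))) =
      (\<Sum>i\<le>k. sym (-1) i ?J * (\<Sum>j\<le>k - i. z (last v) ^ j * sym (-1) (k - i - j) ?K))" .
  show ?thesis
    unfolding kappa_def top last eq by (simp add: sum_distrib_left sum_distrib_right mult_ac)
qed

text \<open>Each summand is up to sign a nef class, since \<open>(- z (last w)) ^ j\<close> is nef;
  below the top degree every summand vanishes, so the alternating signs do no harm.\<close>

lemma degree_sum_last_sym:
  assumes M: "matroid M" and ne: "ground M \<noteq> {}" and nef: "nef (ground M) d f"
    and lt: "k + d < card (ground M) - 1"
  shows "degree_sum (ground M)
    (\<lambda>w. (\<Sum>j\<le>k. z (last w) ^ j * sym (-1) (k - j) (jumps (nullity M) w)) * f w) = 0"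
proof -
  let ?g = "\<lambda>j w. (- z (last w)) ^ j * sym (-1) (k - j) (jumps (nullity M) w) * f w"
  have z: "z x ^ j = (-1) ^ j * (- z x) ^ j" for x j
    by (simp add: power_mult_distrib[symmetric])
  have "degree_sum (ground M)
      (\<lambda>w. (\<Sum>j\<le>k. z (last w) ^ j * sym (-1) (k - j) (jumps (nullity M) w)) * f w) =
    degree_sum (ground M) (\<lambda>w. \<Sum>j\<le>k. (-1) ^ j * ?g j w)"
    unfolding sum_distrib_right z mult.assoc by (rule refl)
  also have "\<dots> = (\<Sum>j\<le>k. (-1) ^ j * degree_sum (ground M) (?g j))"
    by (simp only: degree_sum_sum degree_sum_cmult)
  also have "\<dots> = 0"
  proof (rule sum.neutral, rule ballI)
    fix j assume "j \<in> {..k}"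
    then have deg: "j + (k - j) + d = k + d" by simp
    have "nef (ground M) (j + (k - j) + d) (?g j)"
      by (intro nef_times nef_last nef_sym tame_nullity M ne nef)
    then have "graded (k + d) (card (ground M) - 1) (degree_sum (ground M) (?g j))"
      using graded_degree_sum_nef[OF matroid_finite[OF M] ne] deg by metis
    then show "(-1) ^ j * degree_sum (ground M) (?g j) = 0" using lt by (simp add: graded_def)
  qed
  finally show ?thesis .
qed

text \<open>The integrand has degree \<open>k + n - r\<close>, below the dimension
  \<open>n - 1\<close>.\<close>

lemma degree_sum_kappa_eq_0:
  assumes M: "matroid M" and ne: "ground M \<noteq> {}" and "Suc k < mrank M"
  shows "degree_sum (ground M) (kappa M k) = 0"
proof -
  have "nullity M (ground M) + mrank M = card (ground M)"
    using nullity_add_rk[OF M, of "ground M"] by (simp add: mrank_def)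
  then have "k + nullity M (ground M) < card (ground M) - 1" using assms(3) by linarith
  then show ?thesis
    unfolding kappa_def using degree_sum_last_sym[OF M ne nef_top_class[OF M order_refl]] by blast
qed

text \<open>
  A loop \<open>l\<close> contributes the constant factor \<open>- z l\<close> to the top class, which lowers the degree.
\<close>

lemma degree_sum_kappa_loop:
  assumes M: "matroid M" and loop: "is_loop M l" and k: "k < mrank M"
  shows "degree_sum (ground M) (kappa M k) = 0"
proof -
  let ?E = "ground M" and ?n = "\<lambda>A. nullity M (A - {l})"
  have l: "l \<in> ?E" "rk M {l} = 0" using loop by (auto simp: is_loop_def)
  note t = tame_nullity[OF M]
  note t' = tame_remove[OF t, of l]
  have split: "nullity M A + 0 = ?n A + of_bool (l \<in> A)" if "A \<subseteq> ?E" for A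
  proof (cases "l \<in> A")
    case True
    have sub: "A - {l} \<subseteq> ?E" using that by auto
    have ins: "insert l (A - {l}) = A" using True by auto
    have "rk M A = rk M (A - {l})"
      using rk_insert_le[OF M sub l(1)] rk_mono[OF M _ that, of "A - {l}"] l(2) unfolding ins by auto
    moreover have "card A = Suc (card (A - {l}))"
      using True that matroid_finite[OF M] by (metis card_Suc_Diff1 finite_subset)
    ultimately show ?thesis
      using nullity_add_rk[OF M that] nullity_add_rk[OF M sub] True by simp
  qed simp
  obtain m where m: "nullity M ?E = Suc m" using split[of ?E] l by auto
  have card: "nullity M ?E + mrank M = card ?E"
    using nullity_add_rk[OF M, of ?E] by (simp add: mrank_def)
  have top: "top_class M w = - z l * sym (-1) m (jumps ?n w)" if w: "w \<in> permutations_of_set ?E" for w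
  proof -
    note w' = finite_length_permutations_of_set[OF w]
    \<comment> \<open>Exchange with the condition \<open>l \<in> A\<close>: the root lost is that of
      \<open>l\<close> itself, so no divisor appears.\<close>
    have "sym (-1) (Suc m) (jumps (nullity M) w) = sym (-1) (Suc m) (jumps ?n w) +
        -1 * z l * sym (-1) m (jumps ?n w) + divisor (\<lambda>_. False) w * sym (-1) m (jumps ?n w)"
      by (rule sym_exchange[OF tame_unit_step[OF t] tame_unit_step[OF t'] split _ _ _ l(1) _ w])
         (use l in auto)
    moreover have "card (jumps ?n w) = m"
      using card_jumps[OF tame_unit_step[OF t'] w'(2)] w'(1) split[of ?E] m l
      by (simp add: nullity_empty)
    then have "sym (-1) (Suc m) (jumps ?n w) = 0"
      unfolding sym_def by (intro esym_gt_card) auto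
    ultimately show ?thesis
      using top_class_eq[OF M order_refl w] m by (simp add: divisor_def)
  qed
  have "degree_sum ?E (kappa M k) = degree_sum ?E (\<lambda>w. - z l *
      ((\<Sum>j\<le>k. z (last w) ^ j * sym (-1) (k - j) (jumps (nullity M) w)) * sym (-1) m (jumps ?n w)))"
    by (rule degree_sum_cong) (simp add: kappa_def top)
  also have "\<dots> = - z l * degree_sum ?E (\<lambda>w.
      (\<Sum>j\<le>k. z (last w) ^ j * sym (-1) (k - j) (jumps (nullity M) w)) * sym (-1) m (jumps ?n w))"
    by (rule degree_sum_cmult)
  \<comment> \<open>The remaining degree is \<open>k + m\<close>, where \<open>Suc m\<close> is the
    nullity; it is below \<open>card ?E - 1\<close> because \<open>k < mrank M\<close>.\<close>
  also have "\<dots> = 0"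
    using degree_sum_last_sym[OF M _ nef_sym[OF t'], of k m] l k m card by fastforce
  finally show ?thesis .
qed

text \<open>Since \<open>kappa M k\<close> has degree \<open>k + n - r\<close>, top degree means
  \<open>Suc (k + d) = mrank M\<close>. Induction on the ground set: cutting at \<open>S\<close>
  gives nef degrees on \<open>S\<close> times the same kind of sum for \<open>contract M S\<close>,
  whose flats come from flats of \<open>M\<close>.\<close>

theorem graded_degree_sum_kappa:
  assumes "matroid M" "ground M \<noteq> {}"
    and "\<And>F. flat M F \<Longrightarrow> F \<noteq> ground M \<Longrightarrow>
      degree_sum (ground M - F) (kappa (contract M F) (mrank (contract M F) - 1)) \<in> \<nat>"
    and "nef (ground M) d f"
  shows "graded (Suc (k + d)) (mrank M) (degree_sum (ground M) (\<lambda>w. kappa M k w * f w))"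
  using assms
proof (induction "card (ground M)" arbitrary: M k d f rule: less_induct)
  case less
  note M = less.prems(1) and fin = matroid_finite[OF less.prems(1)]
  let ?E = "ground M"
  show ?case
  proof (cases "k < mrank M")
    \<comment> \<open>Here \<open>Suc (k + d)\<close> exceeds the rank, so nothing is claimed.
      Excluding this case also keeps the subtraction \<open>mrank M - 1 - k\<close> exact.\<close>
    case False
    then show ?thesis by (simp add: graded_def)
  next
    case k: True
    have "graded d (mrank M - 1 - k) (degree_sum ?E (\<lambda>w. kappa M k w * f w))"
    proof (rule graded_degree_sum_times[OF fin _ _ less.prems(4)])
      show "graded 0 (mrank M - 1 - k) (degree_sum ?E (kappa M k))"
      \<comment> \<open>With a loop the empty set is not a flat, but the degree vanishes; without
        loops the assumption at \<open>F = {}\<close> speaks of \<open>M\<close> itself.\<close>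
      proof (cases "\<exists>l. is_loop M l")
        case True
        then show ?thesis using degree_sum_kappa_loop[OF M _ k] by auto
      next
        case False
        have "flat M {}"
          using False rk_empty[OF M] by (auto simp: flat_def is_loop_def)
        then have "degree_sum ?E (kappa M (mrank M - 1)) \<in> \<nat>"
          using less.prems(3)[of "{}"] less.prems(2) contract_empty[OF M] by simp
        moreover have "k = mrank M - 1 \<or> Suc k < mrank M" using k by linarith
        ultimately show ?thesis
          using degree_sum_kappa_eq_0[OF M less.prems(2), of k] by (auto simp: graded_def)
      qed
    next
      fix S d p l q assume S: "S \<subset> ?E" "S \<noteq> {}" and pq: "nef S d p" "nef (?E - S) l q"
      let ?N = "contract M S"
      have S': "S \<subseteq> ?E" using S by simp
      have N: "matroid ?N" using matroid_contract[OF M S'] .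
      have finS: "finite S" using S' fin finite_subset by auto
      have lt: "card (ground ?N) < card ?E"
        using S fin by (auto intro!: psubset_card_mono)
      have ne: "ground ?N \<noteq> {}" using S by auto
      have flatN: "degree_sum (ground ?N - F) (kappa (contract ?N F) (mrank (contract ?N F) - 1)) \<in> \<nat>"
        if F: "flat ?N F" "F \<noteq> ground ?N" for F
      proof -
        have sub: "F \<subseteq> ?E - S" using F by (auto simp: flat_def)
        then have "S \<union> F \<noteq> ?E" using F(2) by auto
        then show ?thesis
          using less.prems(3)[OF flat_contract[OF M S' F(1)]]
          unfolding contract_contract[OF M S' sub] by (simp add: Diff_eq Int_assoc)
      qed
      have "degree_sum2 S (?E - S) (\<lambda>u v. kappa M k (u @ v) * (p u * q v)) =
          degree_sum2 S (?E - S) (\<lambda>u v. \<Sum>i\<le>k.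
            (sym (-1) i (jumps (nullity M) u) * top_class M u * p u) * (kappa ?N (k - i) v * q v))"
      proof (rule degree_sum2_cong)
        fix u v assume uv: "u \<in> permutations_of_set S" "v \<in> permutations_of_set (?E - S)"
        show "kappa M k (u @ v) * (p u * q v) = (\<Sum>i\<le>k.
            (sym (-1) i (jumps (nullity M) u) * top_class M u * p u) * (kappa ?N (k - i) v * q v))"
          unfolding kappa_append[OF M S(1) uv] sum_distrib_right by (simp add: mult_ac)
      qed
      also have "\<dots> = (\<Sum>i\<le>k.
          degree_sum S (\<lambda>u. sym (-1) i (jumps (nullity M) u) * top_class M u * p u) *
          degree_sum (?E - S) (\<lambda>v. kappa ?N (k - i) v * q v))"
        by (simp only: degree_sum2_sum[OF finite_atMost] degree_sum2_tensor)
      also have "graded (Suc (d + l)) (mrank M - 1 - k) \<dots>"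
      proof (rule graded_sum)
        fix i assume "i \<in> {..k}"
        then have i: "i \<le> k" by simp
        have "nef S (i + nullity M S + d)
            (\<lambda>u. sym (-1) i (jumps (nullity M) u) * top_class M u * p u)"
          by (intro nef_times nef_sym tame_subset[OF tame_nullity[OF M] S'] nef_top_class M S' pq)
        then have "graded (i + nullity M S + d) (card S - 1)
            (degree_sum S (\<lambda>u. sym (-1) i (jumps (nullity M) u) * top_class M u * p u))"
          by (rule graded_degree_sum_nef[OF finS S(2)])
        moreover have "graded (Suc (k - i + l)) (mrank ?N)
            (degree_sum (?E - S) (\<lambda>v. kappa ?N (k - i) v * q v))"
          using less.hyps[OF lt N ne flatN, of l q "k - i"] pq(2) by simp
        ultimately have "graded ((i + nullity M S + d) + Suc (k - i + l)) (card S - 1 + mrank ?N)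
            (degree_sum S (\<lambda>u. sym (-1) i (jumps (nullity M) u) * top_class M u * p u) *
             degree_sum (?E - S) (\<lambda>v. kappa ?N (k - i) v * q v))"
          by (rule graded_mult)
        moreover have "card S > 0" using S finS by (simp add: card_gt_0_iff)
        \<comment> \<open>This reduces to \<open>nullity M S + rk M S = card S\<close> and to the
          additivity of rank under contraction.\<close>
        then have "((i + nullity M S + d) + Suc (k - i + l)) + (mrank M - 1 - k) =
            Suc (d + l) + (card S - 1 + mrank ?N)"
          using i k nullity_add_rk[OF M S'] mrank_contract[OF M S'] by linarith
        ultimately show "graded (Suc (d + l)) (mrank M - 1 - k)
            (degree_sum S (\<lambda>u. sym (-1) i (jumps (nullity M) u) * top_class M u * p u) *
             degree_sum (?E - S) (\<lambda>v. kappa ?N (k - i) v * q v))"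
          by (rule graded_shift)
      qed
      finally show "graded (Suc (d + l)) (mrank M - 1 - k)
          (degree_sum2 S (?E - S) (\<lambda>u v. kappa M k (u @ v) * (p u * q v)))" .
    qed
    then show ?thesis by (rule graded_shift) (use k in linarith)
  qed
qed

end

section \<open>Coefficients of the \<open>g\<close>-polynomial\<close>

definition emb :: "'a zpoly \<Rightarrow> 'a zpoly fract" where
  "emb p = Fract p 1"

lemma emb_0 [simp]: "emb 0 = 0" and emb_1 [simp]: "emb 1 = 1"
  by (simp_all add: emb_def Zero_fract_def One_fract_def)

lemma emb_add: "emb (p + q) = emb p + emb q"
  and emb_mult: "emb (p * q) = emb p * emb q"
  and emb_minus: "emb (- p) = - emb p"
  and emb_diff: "emb (p - q) = emb p - emb q"
  by (simp_all add: emb_def)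

lemma emb_sum: "emb (\<Sum>i\<in>I. f i) = (\<Sum>i\<in>I. emb (f i))"
  by (induction I rule: infinite_finite_induct) (simp_all add: emb_add)

lemma emb_prod: "emb (\<Prod>i\<in>I. f i) = (\<Prod>i\<in>I. emb (f i))"
  by (induction I rule: infinite_finite_induct) (simp_all add: emb_mult)

lemma emb_power: "emb (p ^ j) = emb p ^ j"
  by (induction j) (simp_all add: emb_mult)

lemma emb_elem_sym: "emb (elem_sym k xs) = elem_sym k (map emb xs)"
proof -
  have "(\<Prod>i\<in>I. emb (xs ! i)) = (\<Prod>i\<in>I. map emb xs ! i)" if "I \<subseteq> {..<length xs}" for I
    using that by (intro prod.cong) auto
  then show ?thesis by (simp add: elem_sym_def emb_sum emb_prod)
qed

definition zvar :: "'a \<Rightarrow> 'a zpoly fract" where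
  "zvar e = emb (Var e)"

lemma inj_zvar: "inj zvar"
proof (rule injI)
  fix x y :: 'a
  assume "zvar x = zvar y"
  then have "Rep_zpoly (Var x) = Rep_zpoly (Var y)"
    by (simp add: zvar_def emb_def eq_fract)
  then have "Poly_Mapping.keys (Poly_Mapping.single (Poly_Mapping.single x (1::nat)) (1::int)) =
      Poly_Mapping.keys (Poly_Mapping.single (Poly_Mapping.single y (1::nat)) (1::int))"
    by (simp add: Var.rep_eq)
  then have "Poly_Mapping.single x (1::nat) = Poly_Mapping.single y 1" by simp
  then have "Poly_Mapping.keys (Poly_Mapping.single x (1::nat)) =
      Poly_Mapping.keys (Poly_Mapping.single y (1::nat))" by simp
  then show "x = y" by simp
qed

interpretation zv: weights zvar
  by standard (rule inj_zvar)

lemma deg_eq_degree_sum: "deg E f = zv.degree_sum E (\<lambda>w. emb (f w))"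
  unfolding deg_def zv.degree_sum_def
proof (rule sum.cong[OF refl])
  fix w assume "w \<in> permutations_of_set E"
  note w = finite_length_permutations_of_set[OF this]
  have "Fract (f w) q = emb (f w) / emb q" for q by (simp add: emb_def)
  moreover have "emb (\<Prod>i<card E - 1. Var (w ! i) - Var (w ! Suc i)) = zv.den w"
    by (simp add: emb_prod emb_diff zv.den_def zvar_def w(3))
  ultimately show "Fract (f w) (\<Prod>i<card E - 1. Var (w ! i) - Var (w ! Suc i)) =
      emb (f w) / zv.den w" by simp
qed

section \<open>The Chern roots in \<open>x_list\<close> and \<open>y_list\<close> as jumps of rank
  and nullity\<close>

lemma greedy_basis_eq_jumps: "greedy_basis M w = jumps (rk M) w"
  by (simp add: greedy_basis_def jumps_def)

text \<open>A new element raises the cardinality by one, hence raises exactly one of rank and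
  nullity.\<close>

lemma not_greedy_eq_jumps:
  assumes M: "matroid M" and w: "w \<in> permutations_of_set (ground M)"
  shows "{e \<in> set w. e \<notin> greedy_basis M w} = jumps (nullity M) w"
proof -
  note w' = finite_length_permutations_of_set[OF w]
  have "jumps (nullity M) w = set w - jumps (rk M) w"
  proof (rule jumps_complement[OF w'(2)])
    show "set w \<subseteq> ground M" using w' by simp
    fix A x assume A: "A \<subseteq> ground M" and x: "x \<in> ground M - A"
    have ins: "insert x A \<subseteq> ground M" using A x by auto
    have "card (insert x A) = Suc (card A)"
      using x A matroid_finite[OF M] by (simp add: finite_subset)
    then show "nullity M A < nullity M (insert x A) \<longleftrightarrow> \<not> rk M A < rk M (insert x A)"
      using nullity_add_rk[OF M A] nullity_add_rk[OF M ins]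
        unit_stepD[OF tame_unit_step[OF tame_rk[where 'k = int, OF M]] A, of x] x
      by auto
  qed
  then show ?thesis by (auto simp: greedy_basis_eq_jumps)
qed

lemma emb_x_list:
  assumes w: "w \<in> permutations_of_set (ground M)"
  shows "emb (elem_sym k (x_list M w)) = zv.sym 1 k (jumps (rk M) w)"
proof -
  note w' = finite_length_permutations_of_set[OF w]
  have "set (filter (\<lambda>e. e \<in> greedy_basis M w) w) = jumps (rk M) w"
    using jumps_subset[of "rk M" w] by (auto simp: greedy_basis_eq_jumps)
  moreover have "map emb (x_list M w) = map zvar (filter (\<lambda>e. e \<in> greedy_basis M w) w)"
    by (simp add: x_list_def zvar_def)
  ultimately show ?thesis
    using w'(2) by (simp add: emb_elem_sym elem_sym_map zv.sym_def)
qed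

lemma emb_y_list:
  assumes M: "matroid M" and w: "w \<in> permutations_of_set (ground M)"
  shows "emb (elem_sym k (y_list M w)) = zv.sym (-1) k (jumps (nullity M) w)"
    and "emb (elem_sym k (map uminus (y_list M w))) = (-1) ^ k * zv.sym (-1) k (jumps (nullity M) w)"
proof -
  note w' = finite_length_permutations_of_set[OF w]
  let ?ys = "filter (\<lambda>e. e \<notin> greedy_basis M w) (rev w)"
  have ys: "set ?ys = jumps (nullity M) w" "distinct ?ys"
    using not_greedy_eq_jumps[OF M w] w'(2) by auto
  have "map emb (y_list M w) = map (\<lambda>e. -1 * zvar e) ?ys"
    by (simp add: y_list_def zvar_def emb_minus)
  then show "emb (elem_sym k (y_list M w)) = zv.sym (-1) k (jumps (nullity M) w)"
    unfolding emb_elem_sym using elem_sym_map[OF ys(2)] ys(1) by (simp only: zv.sym_def)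
  have "map emb (map uminus (y_list M w)) = map (\<lambda>e. -1 * (-1 * zvar e)) ?ys"
    by (simp add: y_list_def zvar_def)
  then show "emb (elem_sym k (map uminus (y_list M w))) =
      (-1) ^ k * zv.sym (-1) k (jumps (nullity M) w)"
    unfolding emb_elem_sym zv.sym_def esym_scale[of "-1" "\<lambda>e. -1 * zvar e", symmetric]
    using elem_sym_map[OF ys(2)] ys(1) by (simp only:)
qed

text \<open>The definite description in \<open>deg_int\<close> is meaningful only once the degree is
  known to be an integer; being a natural number up to sign suffices.\<close>

lemma of_int_deg_int:
  assumes "deg E f = (-1) ^ m * x" "x \<in> \<nat>"
  shows "of_int (deg_int E f) = deg E f"
proof -
  obtain n where "x = of_nat n" using assms(2) by (auto elim: Nats_cases)
  then have "deg E f = of_int ((-1) ^ m * int n)" using assms(1) by simp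
  then show ?thesis using deg_int_eqI by metis
qed

lemma coeff_minus_monom_power:
  "coeff ((- monom 1 1) ^ i * of_int m) k = (if k = i then (-1) ^ i * m else (0::int))"
proof -
  have "(- monom 1 1 :: int poly) ^ i = monom ((-1) ^ i) i"
    by (induction i) (simp_all add: mult_monom flip: minus_monom)
  then show ?thesis by (simp add: of_int_poly monom_0[symmetric] mult_monom)
qed

lemma coeff_g_poly:
  assumes "ground M \<noteq> {}" "\<And>e. \<not> is_loop M e" "\<And>e. \<not> is_coloop M e"
  shows "coeff (g_poly M) i = (if 1 \<le> i \<and> i \<le> mrank M then
    (-1) ^ card (components M) * ((-1) ^ i * (\<Sum>j = 0..i - 1. deg_int (ground M) (\<lambda>w.
       alpha w ^ j * elem_sym (i - j - 1) (map uminus (y_list M w)) *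
       elem_sym (mrank M - i) (x_list M w) *
       elem_sym (card (ground M) - mrank M) (y_list M w)))) else 0)"
proof -
  let ?d = "\<lambda>i. \<Sum>j = 0..i - 1. deg_int (ground M) (\<lambda>w.
       alpha w ^ j * elem_sym (i - j - 1) (map uminus (y_list M w)) *
       elem_sym (mrank M - i) (x_list M w) *
       elem_sym (card (ground M) - mrank M) (y_list M w))"
  have "g_poly M = (-1) ^ card (components M) *
      (\<Sum>i = 1..mrank M. (- monom 1 1) ^ i * of_int (?d i))"
    using assms by (simp add: g_poly_def Let_def)
  also have "\<dots> = smult ((-1) ^ card (components M))
      (\<Sum>i = 1..mrank M. (- monom 1 1) ^ i * of_int (?d i))"
    by (cases "even (card (components M))") simp_all
  finally have "coeff (g_poly M) i = (-1) ^ card (components M) *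
      (\<Sum>i' = 1..mrank M. if i = i' then (-1) ^ i' * ?d i' else 0)"
    by (simp only: coeff_smult coeff_sum coeff_minus_monom_power)
  then show ?thesis by (simp add: sum.delta')
qed

text \<open>All signs depending on \<open>i\<close> and \<open>j\<close> cancel, leaving a sign that
  depends only on the number of components; it is \<open>+1\<close> for a connected matroid on a
  nonempty set.\<close>

lemma of_int_coeff_g_poly:
  assumes M: "matroid M" and ne: "ground M \<noteq> {}"
    and ll: "\<And>e. \<not> is_loop M e" "\<And>e. \<not> is_coloop M e"
    and i: "1 \<le> i" "i \<le> mrank M"
  shows "of_int (coeff (g_poly M) i) = - ((-1) ^ card (components M)) *
    zv.degree_sum (ground M) (\<lambda>w. zv.kappa M (i - 1) w * zv.sym 1 (mrank M - i) (jumps (rk M) w))"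
proof -
  let ?E = "ground M"
  let ?J = "\<lambda>w. jumps (nullity M) w"
  let ?x = "\<lambda>w. zv.sym 1 (mrank M - i) (jumps (rk M) w)"
  let ?f = "\<lambda>j w. alpha w ^ j * elem_sym (i - j - 1) (map uminus (y_list M w)) *
       elem_sym (mrank M - i) (x_list M w) * elem_sym (card ?E - mrank M) (y_list M w)"
  let ?g = "\<lambda>j w. (- zvar (last w)) ^ j * zv.sym (-1) (i - j - 1) (?J w) * ?x w *
       zv.sym (-1) (card ?E - mrank M) (?J w)"
  have emb: "emb (?f j w) = (-1) ^ (i - j - 1) * ?g j w" if "w \<in> permutations_of_set ?E" for j w
    by (simp add: emb_mult emb_power emb_x_list[OF that] emb_y_list[OF M that] alpha_def emb_minus
          zvar_def)
  have deg: "deg ?E (?f j) = (-1) ^ (i - j - 1) * zv.degree_sum ?E (?g j)" for j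
  proof -
    have "deg ?E (?f j) = zv.degree_sum ?E (\<lambda>w. (-1) ^ (i - j - 1) * ?g j w)"
      unfolding deg_eq_degree_sum by (rule zv.degree_sum_cong) (rule emb)
    then show ?thesis by (simp only: zv.degree_sum_cmult)
  qed
  have card: "nullity M ?E = card ?E - mrank M" "mrank M \<le> card ?E"
    using nullity_add_rk[OF M, of ?E] by (simp_all add: mrank_def)
  have int: "of_int (deg_int ?E (?f j)) = deg ?E (?f j)" if "j \<in> {0..i - 1}" for j
  proof (rule of_int_deg_int[OF deg])
    \<comment> \<open>All four factors are nef and their degrees add up to the dimension, so the
      degree is a natural number.\<close>
    have "zv.nef ?E (j + (i - j - 1) + (mrank M - i) + (card ?E - mrank M)) (?g j)"
      by (intro zv.nef_times zv.nef_last zv.nef_sym tame_nullity tame_rk M ne)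
    moreover have "j + (i - j - 1) + (mrank M - i) + (card ?E - mrank M) = card ?E - 1"
      using that i card by auto
    ultimately show "zv.degree_sum ?E (?g j) \<in> \<nat>"
      using zv.graded_degree_sum_nef[OF matroid_finite[OF M] ne, of "card ?E - 1" "?g j"]
      by (simp add: zv.graded_def)
  qed
  have "(of_int (\<Sum>j = 0..i - 1. deg_int ?E (?f j)) :: 'a zpoly fract) =
      (\<Sum>j = 0..i - 1. (-1) ^ (i - j - 1) * zv.degree_sum ?E (?g j))"
    unfolding of_int_sum by (rule sum.cong[OF refl]) (rule trans[OF int deg])
  also have "\<dots> = zv.degree_sum ?E (\<lambda>w. \<Sum>j = 0..i - 1. (-1) ^ (i - j - 1) * ?g j w)"
    by (simp only: zv.degree_sum_sum zv.degree_sum_cmult)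
  also have "\<dots> = zv.degree_sum ?E (\<lambda>w. (-1) ^ (i - 1) * (zv.kappa M (i - 1) w * ?x w))"
  proof (rule zv.degree_sum_cong)
    fix w assume w: "w \<in> permutations_of_set ?E"
    have "(\<Sum>j = 0..i - 1. (-1) ^ (i - j - 1) * ?g j w) = (\<Sum>j\<le>i - 1. (-1) ^ (i - 1) *
        (zvar (last w) ^ j * zv.sym (-1) (i - 1 - j) (?J w) * (zv.top_class M w * ?x w)))"
    proof (rule sum.cong)
      fix j assume "j \<in> {..i - 1}"
      then have "i - j - 1 + j = i - 1" by auto
      \<comment> \<open>The signs from \<open>e_{i-j-1}(-y)\<close> and from \<open>alpha^j\<close>
        combine to one that is independent of \<open>j\<close>.\<close>
      then have "(-1) ^ (i - j - 1) * (-1) ^ j = ((-1) ^ (i - 1) :: 'a zpoly fract)"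
        unfolding power_add[symmetric] by (rule arg_cong)
      then have "(-1) ^ (i - j - 1) * (- zvar (last w)) ^ j = (-1) ^ (i - 1) * zvar (last w) ^ j"
        by (metis (no_types) mult.assoc mult_minus1 power_mult_distrib)
      then show "(-1) ^ (i - j - 1) * ?g j w = (-1) ^ (i - 1) *
        (zvar (last w) ^ j * zv.sym (-1) (i - 1 - j) (?J w) * (zv.top_class M w * ?x w))"
        unfolding zv.top_class_eq[OF M order_refl w] card(1)
        by (simp add: mult.assoc[symmetric] diff_commute)
    qed auto
    then show "(\<Sum>j = 0..i - 1. (-1) ^ (i - j - 1) * ?g j w) =
        (-1) ^ (i - 1) * (zv.kappa M (i - 1) w * ?x w)"
      by (simp add: zv.kappa_def sum_distrib_left sum_distrib_right mult_ac)
  qed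
  also have "\<dots> = (-1) ^ (i - 1) * zv.degree_sum ?E (\<lambda>w. zv.kappa M (i - 1) w * ?x w)"
    by (rule zv.degree_sum_cmult)
  finally have sum: "(of_int (\<Sum>j = 0..i - 1. deg_int ?E (?f j)) :: 'a zpoly fract) =
      (-1) ^ (i - 1) * zv.degree_sum ?E (\<lambda>w. zv.kappa M (i - 1) w * ?x w)" .
  have "(of_int (coeff (g_poly M) i) :: 'a zpoly fract) = (-1) ^ card (components M) *
      ((-1) ^ i * of_int (\<Sum>j = 0..i - 1. deg_int ?E (?f j)))"
    unfolding coeff_g_poly[OF ne ll] using i by simp
  also have "\<dots> = (-1) ^ card (components M) * ((-1) ^ i * (-1) ^ (i - 1)) *
      zv.degree_sum ?E (\<lambda>w. zv.kappa M (i - 1) w * ?x w)"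
    unfolding sum by (simp only: mult.assoc)
  \<comment> \<open>The sign of \<open>(-t)^i\<close> meets the sign gathered in
    \<open>kappa\<close>; their exponents have odd sum.\<close>
  also have "(-1) ^ i * (-1) ^ (i - 1) = (-1 :: 'a zpoly fract)"
  proof -
    have "i + (i - 1) = Suc (2 * (i - 1))" using i by simp
    then show ?thesis unfolding power_add[symmetric] by (simp add: power_mult)
  qed
  finally show ?thesis by simp
qed

section \<open>Contractions by flats: components, positive rank, absence of loops and
  coloops\<close>

lemma card_components:
  assumes "finite (ground M)" "ground M \<noteq> {}" "connected_matroid M"
  shows "card (components M) = 1"
proof -
  have "finite (components M)" "components M \<noteq> {}"
    using assms(1,2) by (auto simp: components_def quotient_def)
  then have "card (components M) \<noteq> 0" by simp
  then show ?thesis using assms(3) unfolding connected_matroid_def by linarith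
qed

lemma mrank_pos:
  assumes M: "matroid M" and ne: "ground M \<noteq> {}" and "\<And>e. \<not> is_loop M e"
  shows "1 \<le> mrank M"
proof -
  obtain e where e: "e \<in> ground M" using ne by auto
  then have "rk M {e} \<noteq> 0" using assms(3)[of e] by (simp add: is_loop_def)
  then show ?thesis using rk_mono[OF M, of "{e}" "ground M"] e by (simp add: mrank_def)
qed

text \<open>Together with \<open>not_is_coloop_contract\<close> this ensures that the degree
  formula, rather than the value 0, gives the polynomial of a contraction by a proper flat.\<close>

lemma not_is_loop_contract:
  assumes M: "matroid M" and F: "flat M F"
  shows "\<not> is_loop (contract M F) e"
proof
  assume "is_loop (contract M F) e"
  then have e: "e \<in> ground M - F" "rk M (insert e F) - rk M F = 0"
    by (simp_all add: is_loop_def rk_contract)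
  then have "rk M F < rk M (insert e F)" using F unfolding flat_def by blast
  then show False using e(2) by simp
qed

lemma not_is_coloop_contract:
  assumes M: "matroid M" and F: "F \<subseteq> ground M" and "\<And>e. \<not> is_coloop M e"
  shows "\<not> is_coloop (contract M F) e"
proof
  assume *: "is_coloop (contract M F) e"
  then have e: "e \<in> ground M - F" by (simp add: is_coloop_def)
  then have eq: "ground M - F - {e} \<union> F = ground M - {e}" "ground M - F \<union> F = ground M"
    using F by auto
  have "rk M (ground M - {e}) - rk M F < rk M (ground M) - rk M F"
    using * unfolding is_coloop_def mrank_def rk_contract ground_contract eq by blast
  then have "is_coloop M e" using e by (simp add: is_coloop_def mrank_def)
  then show False using assms(3) by blast
qed

lemma is_minor_contract:
  assumes "F \<subseteq> ground M"
  shows "is_minor (contract M F) M"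
proof -
  have "contract M F = delete (contract M F) {}" by (simp add: delete_def contract_def)
  then show ?thesis unfolding is_minor_def using assms by blast
qed

theorem theorem1p5:
  fixes M :: "'a ranked_set"
  assumes "matroid M"
    and "\<And>N. is_minor N M \<Longrightarrow> omega N \<ge> 0"
    and "\<And>F. flat M F \<Longrightarrow> F \<noteq> ground M \<Longrightarrow> connected_matroid (contract M F)"
  shows "\<forall>k. coeff (g_poly M) k \<ge> 0"
proof
  fix i
  note M = assms(1)
  consider "ground M = {}"
    | "ground M \<noteq> {}" "\<exists>e. is_loop M e \<or> is_coloop M e"
    | "ground M \<noteq> {}" "\<And>e. \<not> is_loop M e" "\<And>e. \<not> is_coloop M e" by blast
  then show "0 \<le> coeff (g_poly M) i"
  proof cases
    case 1
    then show ?thesis by (cases i) (simp_all add: g_poly_def)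
  next
    case 2
    then show ?thesis by (simp add: g_poly_def)
  next
    case 3
    \<comment> \<open>For \<open>i\<close> equal to the rank the factor \<open>e_{r-i}(x)\<close> is
      1, so the degree of \<open>kappa\<close> is \<open>omega\<close> of the contraction;
      connectedness makes the sign positive, and the contraction is a minor.\<close>
    have top: "zv.degree_sum (ground M - F) (zv.kappa (contract M F) (mrank (contract M F) - 1)) \<in> \<nat>"
      if F: "flat M F" "F \<noteq> ground M" for F
    proof -
      let ?N = "contract M F"
      have sub: "F \<subseteq> ground M" using F(1) by (simp add: flat_def)
      have N: "matroid ?N" using matroid_contract[OF M sub] .
      have ne: "ground ?N \<noteq> {}" using F sub by auto
      note ll = not_is_loop_contract[OF M F(1)] not_is_coloop_contract[OF M sub 3(3)]
      have r: "1 \<le> mrank ?N" by (rule mrank_pos[OF N ne ll(1)])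
      have c: "card (components ?N) = 1"
        by (rule card_components[OF matroid_finite[OF N] ne assms(3)[OF F]])
      have "zv.degree_sum (ground M - F) (zv.kappa ?N (mrank ?N - 1)) = of_int (omega ?N)"
        using of_int_coeff_g_poly[OF N ne ll r order_refl] c by (simp add: omega_def zv.sym_def)
      moreover have "0 \<le> omega ?N" by (rule assms(2)[OF is_minor_contract[OF sub]])
      then obtain m where "omega ?N = int m" by (rule nonneg_int_cases)
      ultimately show ?thesis by simp
    qed
    show ?thesis
    proof (cases "1 \<le> i \<and> i \<le> mrank M")
      case True
      \<comment> \<open>Without loops the empty set is a proper flat, so \<open>M\<close> itself is
        connected and has the same sign as its contractions.\<close>
      have "flat M {}" using 3(2) rk_empty[OF M] by (auto simp: flat_def is_loop_def)
      then have c: "card (components M) = 1"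
        using assms(3)[of "{}"] 3(1) card_components[OF matroid_finite[OF M] 3(1)]
        by (simp add: contract_empty[OF M])
      \<comment> \<open>The factor \<open>e_{r-i}(x)\<close> is a Chern class of the dual
        tautological subbundle, hence nef of degree \<open>mrank M - i\<close>, which is exactly the
        top degree here.\<close>
      have "zv.graded (Suc (i - 1 + (mrank M - i))) (mrank M) (zv.degree_sum (ground M)
          (\<lambda>w. zv.kappa M (i - 1) w * zv.sym 1 (mrank M - i) (jumps (rk M) w)))"
        by (rule zv.graded_degree_sum_kappa[OF M 3(1) top zv.nef_sym[OF tame_rk[OF M]]])
      moreover have "Suc (i - 1 + (mrank M - i)) = mrank M" using True by simp
      ultimately have "(of_int (coeff (g_poly M) i) :: 'a zpoly fract) \<in> \<nat>"
        using of_int_coeff_g_poly[OF M 3] True c by (simp add: zv.graded_def)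
      then obtain m where "(of_int (coeff (g_poly M) i) :: 'a zpoly fract) = of_int (int m)"
        by (auto elim: Nats_cases)
      then show ?thesis by (simp only: zpoly_fract_of_int_eq_iff)
    next
      case False
      have "coeff (g_poly M) i = 0" unfolding coeff_g_poly[OF 3] by (rule if_not_P[OF False])
      then show ?thesis by simp
    qed
  qed
qed

end
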